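(* Let $\tau\in\mathbb{C}$ with $\operatorname{Im}\tau>0$, put $q=e^{2\pi i\tau}$, and let $m,n$ be positive integers. Suppose $y_1,y_2,\dots,y_n$ are complex numbers with $y_1+y_2+\cdots+y_n=0$. Then for all $z\in\mathbb{C}$, $$\sum_{k=0}^{mn-1}q^{k^2/2}e^{2kiz}\prod_{j=1}^{n}\theta_3\!\left(mz+y_j+km\pi\tau\,\big|\,m^2n\tau\right)=F_{m,n}(y_1,\dots,y_n|\tau)\,\theta_3(z|\tau),$$ where $$F_{m,n}(y_1,\dots,y_n|\tau)=\frac{(-i\tau)^{\frac{1-n}{2}}}{(m^2n)^{\frac n2}}\,e^{\frac{y_1^2+\cdots+y_n^2}{m^2n\pi\tau i}}\;G_{m,n}\!\left(\frac{y_1}{m^2n\tau},\dots,\frac{y_n}{m^2n\tau}\,\Big|\,-\frac{1}{m^2n\tau}\right)$$ $$=\sum_{k=0}^{n-1}q^{-\frac{m^2k^2}{2}}\sum_{\substack{r_1,\dots,r_n\in\mathbb{Z}\\ r_1+\cdots+r_n=k}}q^{\frac12 m^2n(r_1^2+\cdots+r_n^2)}e^{-2i(r_1y_1+\cdots+r_ny_n)}.$$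
   Context: Throughout, $q=e^{2\pi i\tau}$ with $\operatorname{Im}\tau>0$ (and $q^{a}$ means $e^{2\pi i\tau a}$). The Jacobi theta function is $\theta_3(z|\tau)=\sum_{n=-\infty}^{\infty}q^{n^2/2}e^{2niz}$. For complex $y_1,\dots,y_n$ with $y_1+\cdots+y_n=0$, $$G_{m,n}(y_1,\dots,y_n|\tau)=mn\sum_{\substack{r_1,\dots,r_n\in\mathbb{Z}\\ r_1+\cdots+r_n=0}}q^{\frac12(r_1^2+\cdots+r_n^2)}e^{2i(r_1y_1+\cdots+r_ny_n)}.$$ The power $(-i\tau)^{\frac{1-n}{2}}$ is taken with the principal branch. *)

theory Defs
  imports "HOL-Analysis.Analysis"
begin

definition qpow :: "complex \<Rightarrow> complex \<Rightarrow> complex" where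
  "qpow \<tau> a = exp (2 * of_real pi * \<i> * \<tau> * a)"

definition theta3 :: "complex \<Rightarrow> complex \<Rightarrow> complex" where
  "theta3 z \<tau> = (\<Sum>\<^sub>\<infinity>k::int. qpow \<tau> (of_int k ^ 2 / 2) * exp (2 * of_int k * \<i> * z))"

definition int_vecs :: "nat \<Rightarrow> int \<Rightarrow> (nat \<Rightarrow> int) set" where
  "int_vecs n s = {r. (\<forall>j. j \<notin> {1..n} \<longrightarrow> r j = 0) \<and> (\<Sum>j=1..n. r j) = s}"

definition G :: "nat \<Rightarrow> nat \<Rightarrow> (nat \<Rightarrow> complex) \<Rightarrow> complex \<Rightarrow> complex" where
  "G m n y \<tau> = of_nat (m * n) *
     (\<Sum>\<^sub>\<infinity>r\<in>int_vecs n 0. qpow \<tau> ((\<Sum>j=1..n. of_int (r j ^ 2)) / 2)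
        * exp (2 * \<i> * (\<Sum>j=1..n. of_int (r j) * y j)))"

definition F :: "nat \<Rightarrow> nat \<Rightarrow> (nat \<Rightarrow> complex) \<Rightarrow> complex \<Rightarrow> complex" where
  "F m n y \<tau> =
     (- \<i> * \<tau>) powr ((1 - of_nat n) / 2) / (of_nat (m^2 * n)) powr (of_nat n / 2)
     * exp ((\<Sum>j=1..n. y j ^ 2) / (of_nat (m^2 * n) * of_real pi * \<tau> * \<i>))
     * G m n (\<lambda>j. y j / (of_nat (m^2 * n) * \<tau>)) (- 1 / (of_nat (m^2 * n) * \<tau>))"

end

theory Submission
  imports Defs "HOL-Complex_Analysis.Complex_Analysis" "HOL-Probability.Probability"
begin

text \<open>
  By evenness of \<open>\<theta>\<^sub>3\<close>, expand the product of thetas with \<open>-r\<close> for \<open>r \<in> \<int>\<^sup>n\<close> and split each \<open>r\<close> as \<open>r' + t (1, \<dots>, 1)\<close> with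
  \<open>0 \<le> \<Sum> r' < n\<close>. As \<open>\<Sum> y = 0\<close>, the summand is a coefficient depending on \<open>r'\<close> alone times the
  theta term of index \<open>k - m \<Sum> r' - m n t\<close>, and these indices run exactly once through \<open>\<int>\<close>. So the
  left-hand side is the second form of \<open>F\<close> times \<open>\<theta>\<^sub>3(z|\<tau>)\<close>.

  Apply instead Jacobi's inversion formula to every factor first. The Gaussian prefactors cancel
  \<open>q\<^bsup>k^2/2\<^esup> e\<^bsup>2kiz\<^esup>\<close>, and \<open>k\<close> survives only in the roots of unity \<open>e\<^bsup>2\<pi>ik(\<Sum> r)/(mn)\<^esup>\<close>; summing over \<open>k\<close>
  retains the vectors with \<open>mn\<close> dividing \<open>\<Sum> r\<close>, which are \<open>r' + m t (1, \<dots>, 1)\<close> with \<open>\<Sum> r' = 0\<close>. A second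
  inversion gives the first form of \<open>F\<close> times \<open>\<theta>\<^sub>3(z|\<tau>)\<close>. The two forms agree since \<open>\<theta>\<^sub>3(\<cdot>|\<tau>)\<close> has mean value 1
  and hence is not identically zero.

  The inversion formula is Poisson summation for a real Gaussian: the periodized Gaussian and the
  theta series are continuous with the same Fourier coefficients.
\<close>

section \<open>Uniqueness of Fourier coefficients\<close>

text \<open>An inductive closure rather than an explicit family of coefficients: claims linear in
  the function reduce to a single exponential by rule induction. The period is 1.\<close>

inductive trig_poly :: "(real \<Rightarrow> complex) \<Rightarrow> bool" where
  mono: "trig_poly (\<lambda>x. c * cis (2 * pi * of_int k * x))"
| add: "trig_poly f \<Longrightarrow> trig_poly g \<Longrightarrow> trig_poly (\<lambda>x. f x + g x)"

lemma trig_poly_mult_mono: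
  "trig_poly g \<Longrightarrow> trig_poly (\<lambda>x. c * cis (2 * pi * of_int k * x) * g x)"
proof (induction rule: trig_poly.induct)
  case (mono d l)
  have "(\<lambda>x. c * cis (2 * pi * of_int k * x) * (d * cis (2 * pi * of_int l * x)))
      = (\<lambda>x. (c * d) * cis (2 * pi * of_int (k + l) * x))"
    by (rule ext) (simp add: cis_mult [symmetric] algebra_simps)
  then show ?case using trig_poly.mono[of "c * d" "k + l"] by simp
next
  case (add f g)
  then show ?case using trig_poly.add[OF add.IH] by (simp add: algebra_simps)
qed

lemma trig_poly_mult: "trig_poly f \<Longrightarrow> trig_poly g \<Longrightarrow> trig_poly (\<lambda>x. f x * g x)"
proof (induction rule: trig_poly.induct)
  case (mono c k)
  then show ?case by (rule trig_poly_mult_mono)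
next
  case (add f f')
  then show ?case using trig_poly.add[OF add.IH] by (simp add: algebra_simps)
qed

lemma trig_poly_const: "trig_poly (\<lambda>x. c)"
  using trig_poly.mono[of c 0] by simp

text \<open>On the unit circle the real and imaginary parts of w are combinations of w and cnj w =
  1/w, so real polynomials on the plane restrict to trigonometric polynomials.\<close>

lemma trig_poly_real_polynomial:
  assumes "real_polynomial_function p"
  shows "trig_poly (\<lambda>x. complex_of_real (p (cis (2 * pi * x))))"
  using assms
proof (induction rule: real_polynomial_function.induct)
  case (linear f)
  interpret bounded_linear f by fact
  define a b where "a = f 1" and "b = f \<i>"
  have f: "f z = Re z * a + Im z * b" for z
  proof -
    have "f z = f (Re z *\<^sub>R 1 + Im z *\<^sub>R \<i>)"
      by (rule arg_cong[where f=f]) (simp add: complex_eq_iff)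
    also have "\<dots> = Re z * a + Im z * b"
      by (simp add: add scaleR a_def b_def)
    finally show ?thesis .
  qed
  \<comment> \<open>Substitutes Re w = (w + cnj w)/2 and Im w = (w - cnj w)/(2i) into Re w * a + Im
    w * b.\<close>
  have "(\<lambda>x. complex_of_real (f (cis (2 * pi * x))))
     = (\<lambda>x. (a - \<i> * b) / 2 * cis (2 * pi * of_int 1 * x) + (a + \<i> * b) / 2 * cis (2 * pi * of_int (-1) * x))"
    by (rule ext) (simp add: f complex_eq_iff field_simps)
  then show ?case
    using trig_poly.add[OF trig_poly.mono trig_poly.mono,
        of "(a - \<i> * b) / 2" 1 "(a + \<i> * b) / 2" "-1"] by (simp only:)
next
  case (const c)
  then show ?case by (rule trig_poly_const)
next
  case (add f g)
  then show ?case using trig_poly.add[OF add.IH] by simp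
next
  case (mult f g)
  then show ?case using trig_poly_mult[OF mult.IH] by simp
qed

lemma trig_poly_polynomial:
  fixes p :: "complex \<Rightarrow> complex"
  assumes "polynomial_function p"
  shows "trig_poly (\<lambda>x. p (cis (2 * pi * x)))"
proof -
  have "real_polynomial_function (\<lambda>z. Re (p z))" "real_polynomial_function (\<lambda>z. Im (p z))"
    using assms bounded_linear_Re bounded_linear_Im unfolding polynomial_function_def o_def by blast+
  then have "trig_poly (\<lambda>x. complex_of_real (Re (p (cis (2*pi*x)))) + \<i> * complex_of_real (Im (p (cis (2*pi*x)))))"
    by (intro trig_poly.add trig_poly_mult trig_poly_const trig_poly_real_polynomial)
  moreover have "(\<lambda>x. complex_of_real (Re (p (cis (2*pi*x)))) + \<i> * complex_of_real (Im (p (cis (2*pi*x)))))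
     = (\<lambda>x. p (cis (2 * pi * x)))"
    by (rule ext) (simp add: complex_eq_iff)
  ultimately show ?thesis by simp
qed

section \<open>Periodic functions as functions on the circle\<close>

lemma periodic_add_int:
  fixes h :: "real \<Rightarrow> 'a"
  assumes "\<And>x. h (x + 1) = h x"
  shows "h (x + of_int k) = h x"
proof (induction k rule: int_induct[where k=0])
  case (step1 i)
  then show ?case using assms[of "x + of_int i"] by (simp add: algebra_simps)
next
  case (step2 i)
  then show ?case using assms[of "x + of_int i - 1"] by (simp add: algebra_simps)
qed simp

text \<open>The circle is the compact domain on which Stone-Weierstrass applies. \<open>Arg\<close>
  jumps at the negative real axis; there continuity is due to the periodicity of
  \<open>h\<close>.\<close>

lemma periodic_descends_to_circle:
  fixes h :: "real \<Rightarrow> 'a::topological_space"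
  assumes cont: "continuous_on UNIV h" and per: "\<And>x. h (x + 1) = h x"
  obtains H where "continuous_on (sphere (0::complex) 1) H" "\<And>x. H (cis (2 * pi * x)) = h x"
proof
  define H where "H w = h (Arg w / (2 * pi))" for w :: complex
  show H: "H (cis (2 * pi * x)) = h x" for x
  proof -
    have "cis (Arg (cis (2 * pi * x))) = cis (2 * pi * x)"
      by (subst cis_Arg) (auto simp: sgn_eq)
    then have "exp (\<i> * Arg (cis (2 * pi * x))) = exp (\<i> * of_real (2 * pi * x))"
      by (simp add: cis_conv_exp)
    then obtain k :: int where "\<i> * Arg (cis (2 * pi * x)) = \<i> * of_real (2 * pi * x) + (of_int (2 * k) * pi) * \<i>"
      using exp_eq by blast
    then have "complex_of_real (Arg (cis (2 * pi * x))) = of_real (2 * pi * x + of_int (2 * k) * pi)"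
      by (auto simp: complex_eq_iff)
    then have "Arg (cis (2 * pi * x)) = 2 * pi * x + of_int (2 * k) * pi"
      using of_real_eq_iff by blast
    then have "Arg (cis (2 * pi * x)) / (2 * pi) = x + of_int k"
      by (simp add: field_simps)
    then show ?thesis
      unfolding H_def using periodic_add_int[of h x k] per by simp
  qed
  show "continuous_on (sphere 0 1) H"
    unfolding continuous_on_eq_continuous_within
  proof
    fix w0 :: complex assume w0: "w0 \<in> sphere 0 1"
    define x0 where "x0 = Arg w0 / (2 * pi)"
    have w0_eq: "w0 = cis (2 * pi * x0)"
      using w0 cis_Arg[of w0] by (cases "w0 = 0") (simp_all add: x0_def sgn_eq)
    \<comment> \<open>The angle is measured relative to \<open>w0\<close>: for w near
      \<open>w0\<close> the quotient \<open>w / w0\<close> is close to 1, hence off the branch cut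
      of \<open>Ln\<close>. Periodicity makes the formula valid on the whole circle.\<close>
    have eq: "H w = h (x0 + Im (Ln (w / w0)) / (2 * pi))" if "w \<in> sphere 0 1" for w
    proof -
      have nz: "w / w0 \<noteq> 0" and n1: "norm (w / w0) = 1" using that w0 by (auto simp: norm_divide)
      have "cis (Im (Ln (w / w0))) = w / w0"
        using nz n1 cis_Arg[of "w/w0"] by (simp add: Arg_eq_Im_Ln sgn_eq)
      then have "w = cis (2 * pi * (x0 + Im (Ln (w / w0)) / (2 * pi)))"
        using w0 by (auto simp: w0_eq[symmetric] distrib_left cis_mult[symmetric])
      then show ?thesis using H by metis
    qed
    have "continuous (at w0 within sphere 0 1) (\<lambda>w. h (x0 + Im (Ln (w / w0)) / (2 * pi)))"
    proof -
      have "isCont (\<lambda>w. x0 + Im (Ln (w / w0)) / (2 * pi)) w0"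
      proof -
        have "isCont (\<lambda>w. w / w0) w0" "isCont Ln (w0 / w0)"
          using w0 by (auto intro!: continuous_intros continuous_at_Ln)
        then have "isCont (\<lambda>w. Ln (w / w0)) w0" by (rule isCont_o2)
        then show ?thesis by (intro continuous_intros) auto
      qed
      moreover have "isCont h (x0 + Im (Ln (w0 / w0)) / (2 * pi))"
        using cont by (simp add: continuous_on_eq_continuous_at)
      ultimately have "isCont (\<lambda>w. h (x0 + Im (Ln (w / w0)) / (2 * pi))) w0"
        by (rule isCont_o2)
      then show ?thesis by (rule continuous_at_imp_continuous_at_within)
    qed
    then show "continuous (at w0 within sphere 0 1) H"
      by (rule continuous_transform_within[where \<delta>=1]) (use w0 eq in auto)
  qed
qed

lemma trig_poly_orthogonal:
  fixes h :: "real \<Rightarrow> complex"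
  assumes "trig_poly p" and cont: "continuous_on {0..1} h"
    and "\<And>k::int. integral {0..1} (\<lambda>x. h x * cis (2 * pi * of_int k * x)) = 0"
  shows "((\<lambda>x. h x * p x) has_integral 0) {0..1}"
  using assms(1)
proof (induction rule: trig_poly.induct)
  case (mono c k)
  have "(\<lambda>x. h x * cis (2 * pi * of_int k * x)) integrable_on {0..1}"
    by (intro integrable_continuous_real continuous_intros cont)
  then have "((\<lambda>x. h x * cis (2 * pi * of_int k * x)) has_integral 0) {0..1}"
    using assms(3)[of k] by (metis has_integral_integral)
  from has_integral_mult_right[OF this, of c] show ?case by (simp add: algebra_simps)
next
  case (add f g)
  from has_integral_add[OF add.IH] show ?case by (simp add: algebra_simps)
qed

text \<open>\<open>h\<close> is orthogonal to every trigonometric polynomial p. If p is uniformly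
  within e of cnj h, the integral of |h|^2 equals that of h (cnj h - p), which is at most e times
  the integral of |h|.\<close>

lemma fourier_coefficients_zero_imp_zero:
  fixes h :: "real \<Rightarrow> complex"
  assumes cont: "continuous_on UNIV h" and per: "\<And>x. h (x + 1) = h x"
    and zero: "\<And>k::int. integral {0..1} (\<lambda>x. h x * cis (2 * pi * of_int k * x)) = 0"
  shows "h x = 0"
proof -
  obtain H where H: "continuous_on (sphere (0::complex) 1) H" "\<And>x. H (cis (2 * pi * x)) = h x"
    using periodic_descends_to_circle[OF cont per] by blast
  have cont': "continuous_on {0..1} h" using cont continuous_on_subset by blast
  define I where "I = integral {0..1} (\<lambda>x. norm (h x) ^ 2)"
  define J where "J = integral {0..1} (\<lambda>x. norm (h x))"
  have int2: "(\<lambda>x. norm (h x) ^ 2) integrable_on {0..1}"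
    by (intro integrable_continuous_real continuous_intros cont')
  have int1: "(\<lambda>x. norm (h x)) integrable_on {0..1}"
    by (intro integrable_continuous_real continuous_intros cont')
  have J0: "J \<ge> 0" unfolding J_def by (intro integral_nonneg int1) auto
  have bound: "I \<le> e * J" if "e > 0" for e
  proof -
    have "continuous_on (sphere 0 1) (\<lambda>w. cnj (H w))" by (intro continuous_intros H)
    then obtain g where g: "polynomial_function g" "\<And>w. w \<in> sphere 0 1 \<Longrightarrow> norm (cnj (H w) - g w) < e"
      using Stone_Weierstrass_polynomial_function[of "sphere 0 1" "\<lambda>w. cnj (H w)" e] \<open>e > 0\<close> by auto
    define p where "p x = g (cis (2 * pi * x))" for x
    have p: "trig_poly p" unfolding p_def using trig_poly_polynomial[OF g(1)] .
    have pb: "norm (cnj (h x) - p x) \<le> e" for x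
      using g(2)[of "cis (2*pi*x)"] by (simp add: p_def H(2) less_imp_le)
    have "((\<lambda>x. of_real (norm (h x) ^ 2)) has_integral complex_of_real I) {0..1}"
      using int2 by (intro has_integral_of_real) (auto simp: I_def has_integral_integral)
    from has_integral_diff[OF this trig_poly_orthogonal[OF p cont' zero]]
    have *: "((\<lambda>x. h x * (cnj (h x) - p x)) has_integral complex_of_real I) {0..1}"
      by (simp add: complex_norm_square algebra_simps flip: of_real_power)
    have "norm (integral {0..1} (\<lambda>x. h x * (cnj (h x) - p x))) \<le> integral {0..1} (\<lambda>x. e * norm (h x))"
    proof (rule integral_norm_bound_integral)
      show "(\<lambda>x. h x * (cnj (h x) - p x)) integrable_on {0..1}" using * by blast
      show "(\<lambda>x. e * norm (h x)) integrable_on {0..1}"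
        using int1 by (rule integrable_on_mult_right)
      show "norm (h x * (cnj (h x) - p x)) \<le> e * norm (h x)" for x
        using mult_right_mono[OF pb, of "norm (h x)" x] by (simp add: norm_mult mult.commute)
    qed
    then have "\<bar>I\<bar> \<le> e * J" using * by (simp add: integral_unique J_def)
    then show ?thesis by linarith
  qed
  have "I \<le> 0"
  proof (rule field_le_epsilon)
    fix e :: real assume "e > 0"
    \<comment> \<open>The denominator \<open>J + 1\<close> instead of \<open>J\<close> covers the
      case \<open>J = 0\<close>.\<close>
    have "I \<le> e / (J + 1) * J" using bound[of "e / (J+1)"] \<open>e > 0\<close> J0 by auto
    also have "\<dots> \<le> e" using \<open>e > 0\<close> J0 by (simp add: field_simps)
    finally show "I \<le> 0 + e" by simp
  qed
  moreover have "I \<ge> 0" unfolding I_def by (intro integral_nonneg int2) auto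
  ultimately have "((\<lambda>x. norm (h x) ^ 2) has_integral 0) {0..1}"
    using int2 by (simp add: I_def has_integral_iff)
  moreover have "continuous_on {0..1} (\<lambda>x. norm (h x) ^ 2)" by (intro continuous_intros cont')
  ultimately have "norm (h y) ^ 2 = 0" if "y \<in> {0..1}" for y
    using that has_integral_0_cbox_imp_0[of 0 1 "\<lambda>x. norm (h x) ^ 2" y] by auto
  then have "h (frac x) = 0" by (simp add: frac_lt_1 less_imp_le)
  then show ?thesis
    using periodic_add_int[of h "frac x" "\<lfloor>x\<rfloor>"] per by (simp add: frac_def)
qed

section \<open>Convergence of theta series\<close>

lemma summable_on_int_exp_minus_abs: "(\<lambda>k::int. exp (- \<bar>real_of_int k\<bar>)) summable_on UNIV"
proof -
  have nat: "(\<lambda>n::nat. exp (- real n)) summable_on UNIV"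
  proof -
    have "summable (\<lambda>n. exp (-1::real) ^ n)" by (intro summable_geometric) auto
    also have "(\<lambda>n. exp (-1::real) ^ n) = (\<lambda>n. exp (- real n))"
      by (simp add: exp_of_nat_mult[symmetric])
    finally show ?thesis by (subst summable_on_UNIV_nonneg_real_iff) auto
  qed
  have "(\<lambda>k::int. exp (- \<bar>real_of_int k\<bar>)) summable_on {0..}"
    by (subst summable_on_reindex_bij_witness[where j=nat and i=int and T=UNIV and h="\<lambda>n. exp (- real n)"])
       (use nat in auto)
  moreover have "(\<lambda>k::int. exp (- \<bar>real_of_int k\<bar>)) summable_on {..<0}"
    by (subst summable_on_reindex_bij_witness[where j="\<lambda>k. nat (-1 - k)" and i="\<lambda>n. -1 - int n" and T=UNIV
          and h="\<lambda>n. exp (-1) * exp (- real n)"])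
       (use summable_on_cmult_right[OF nat, of "exp (-1)"] in \<open>auto simp: exp_add[symmetric]\<close>)
  ultimately have "(\<lambda>k::int. exp (- \<bar>real_of_int k\<bar>)) summable_on ({0..} \<union> {..<0})"
    by (intro summable_on_Un_disjoint) auto
  also have "{0..} \<union> {..<0} = (UNIV :: int set)" by auto
  finally show ?thesis .
qed

text \<open>The quadratic term absorbs any linear one: completing the square bounds each term by a
  constant times exp(-|k|).\<close>

lemma summable_on_int_gaussian:
  assumes "a > 0"
  shows "(\<lambda>k::int. exp (b * \<bar>of_int k\<bar> - a * of_int k ^ 2 :: real)) summable_on UNIV"
proof -
  \<comment> \<open>The maximum over real x of (b + 1) x - a x^2; the extra 1 leaves the decay
    exp(-x).\<close>
  define C where "C = (b + 1)\<^sup>2 / (4 * a)"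
  have "(\<lambda>k::int. exp C * exp (- \<bar>real_of_int k\<bar>)) summable_on UNIV"
    using summable_on_int_exp_minus_abs by (rule summable_on_cmult_right)
  then have "(\<lambda>k::int. norm (exp (b * \<bar>of_int k\<bar> - a * of_int k ^ 2 :: real))) summable_on UNIV"
  proof (rule Infinite_Sum.abs_summable_on_comparison_test')
    fix k :: int
    define x where "x = \<bar>real_of_int k\<bar>"
    have "0 \<le> (2 * a * x - (b + 1))\<^sup>2 / (4 * a)" using assms by simp
    also have "\<dots> = a * x\<^sup>2 - (b + 1) * x + C"
      using assms by (simp add: C_def power2_eq_square field_simps)
    finally have "b * x - a * x\<^sup>2 \<le> C - x" by (simp add: algebra_simps)
    then show "norm (exp (b * \<bar>of_int k\<bar> - a * of_int k ^ 2 :: real)) \<le> exp C * exp (- \<bar>real_of_int k\<bar>)"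
      by (simp add: x_def exp_add[symmetric])
  qed
  then show ?thesis by simp
qed

text \<open>One exponential instead of a product of two, so that identities between terms become
  identities between exponents.\<close>

abbreviation theta_term :: "complex \<Rightarrow> complex \<Rightarrow> int \<Rightarrow> complex" where
  "theta_term z \<tau> k \<equiv> exp (of_real pi * \<i> * \<tau> * of_int k ^ 2 + 2 * of_int k * \<i> * z)"

lemma theta3_eq: "theta3 z \<tau> = (\<Sum>\<^sub>\<infinity>k. theta_term z \<tau> k)"
  unfolding theta3_def qpow_def by (intro infsum_cong) (simp add: exp_add mult.assoc)

text \<open>The bound depends only on a lower bound for Im \<tau> and an upper bound for the norm of
  z, as the M-test on compact sets requires.\<close>

lemma norm_theta_term_le:
  assumes "Im \<tau> \<ge> \<epsilon>" "norm z \<le> R"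
  shows "norm (theta_term z \<tau> k) \<le> exp ((2 * R) * \<bar>of_int k\<bar> - (pi * \<epsilon>) * of_int k ^ 2)"
proof -
  have "norm (theta_term z \<tau> k) = exp (- pi * Im \<tau> * of_int k ^ 2 - 2 * of_int k * Im z)"
    by (simp add: norm_exp_eq_Re flip: of_int_power)
  also have "\<dots> \<le> exp ((2 * R) * \<bar>of_int k\<bar> - (pi * \<epsilon>) * of_int k ^ 2)"
  proof -
    have "- (of_int k * Im z) \<le> \<bar>of_int k\<bar> * \<bar>Im z\<bar>"
      by (metis abs_ge_minus_self abs_mult)
    also have "\<dots> \<le> \<bar>of_int k\<bar> * R"
      using assms(2) abs_Im_le_cmod[of z] by (intro mult_left_mono) auto
    finally have "- (of_int k * Im z) \<le> \<bar>of_int k\<bar> * R" .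
    moreover have "pi * \<epsilon> * of_int k ^ 2 \<le> pi * Im \<tau> * of_int k ^ 2"
      using assms(1) by (intro mult_right_mono mult_left_mono) auto
    ultimately show ?thesis by (simp only: exp_le_cancel_iff, simp only: mult_minus_left mult.assoc)
      (use mult.commute[of R "\<bar>of_int k\<bar>"] in linarith)
  qed
  finally show ?thesis .
qed

lemma theta_term_abs_summable:
  assumes "Im \<tau> > 0"
  shows "(\<lambda>k. norm (theta_term z \<tau> k)) summable_on UNIV"
proof (rule Infinite_Sum.abs_summable_on_comparison_test')
  show "(\<lambda>k. exp ((2 * norm z) * \<bar>of_int k\<bar> - (pi * Im \<tau>) * of_int k ^ 2)) summable_on UNIV"
    using assms by (intro summable_on_int_gaussian) auto
qed (rule norm_theta_term_le, auto)

lemma theta_term_summable: "Im \<tau> > 0 \<Longrightarrow> theta_term z \<tau> summable_on UNIV"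
  using theta_term_abs_summable by (rule abs_summable_summable)

text \<open>With both arguments functions of one variable, the same statement serves continuation in
  the modulus, where \<open>- 1 / \<tau>\<close> occurs, and in the argument.\<close>

lemma holomorphic_theta3:
  assumes "open S" and h: "h holomorphic_on S" and g: "g holomorphic_on S"
    and pos: "\<And>w. w \<in> S \<Longrightarrow> Im (g w) > 0"
  shows "(\<lambda>w. theta3 (h w) (g w)) holomorphic_on S"
proof -
  have "(\<lambda>w. theta3 (h w) (g w)) field_differentiable (at w)" if w: "w \<in> S" for w
  proof -
    obtain r where r: "r > 0" "cball w r \<subseteq> S"
      using \<open>open S\<close> w open_contains_cball by blast
    have ch: "continuous_on (cball w r) h" and cg: "continuous_on (cball w r) g"
      using h g r holomorphic_on_imp_continuous_on continuous_on_subset by blast+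
    have ne: "cball w r \<noteq> {}" using r by auto
    \<comment> \<open>On the closed disc Im g attains a minimum, positive by \<open>pos\<close>, and
      |h| a maximum; these are the constants of the majorant.\<close>
    have "continuous_on (cball w r) (\<lambda>w. Im (g w))" by (intro continuous_intros cg)
    then obtain u where u: "u \<in> cball w r" "\<And>v. v \<in> cball w r \<Longrightarrow> Im (g u) \<le> Im (g v)"
      using continuous_attains_inf[OF compact_cball ne] by blast
    have "continuous_on (cball w r) (\<lambda>w. norm (h w))" by (intro continuous_intros ch)
    then obtain v where v: "\<And>x. x \<in> cball w r \<Longrightarrow> norm (h x) \<le> norm (h v)"
      using continuous_attains_sup[OF compact_cball ne] by blast
    have "uniform_limit (cball w r) (\<lambda>X x. \<Sum>k\<in>X. theta_term (h x) (g x) k)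
            (\<lambda>x. \<Sum>\<^sub>\<infinity>k. theta_term (h x) (g x) k) (finite_subsets_at_top UNIV)"
    proof (rule Weierstrass_m_test_general)
      show "(\<lambda>k. exp ((2 * norm (h v)) * \<bar>of_int k\<bar> - (pi * Im (g u)) * of_int k ^ 2)) summable_on UNIV"
        using pos u r by (intro summable_on_int_gaussian mult_pos_pos) auto
      fix x assume "x \<in> cball w r"
      then show "norm (theta_term (h x) (g x) k)
          \<le> exp ((2 * norm (h v)) * \<bar>of_int k\<bar> - (pi * Im (g u)) * of_int k ^ 2)" for k
        using u v by (intro norm_theta_term_le) auto
    qed
    then have ul: "uniform_limit (cball w r) (\<lambda>X x. \<Sum>k\<in>X. theta_term (h x) (g x) k)
            (\<lambda>x. theta3 (h x) (g x)) (finite_subsets_at_top UNIV)"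
      by (simp only: theta3_eq)
    have "(\<lambda>x. \<Sum>k\<in>X. theta_term (h x) (g x) k) holomorphic_on S" for X
      by (intro holomorphic_intros h g)
    then have "continuous_on (cball w r) (\<lambda>x. \<Sum>k\<in>X. theta_term (h x) (g x) k) \<and>
        (\<lambda>x. \<Sum>k\<in>X. theta_term (h x) (g x) k) holomorphic_on ball w r" for X
      using r ball_subset_cball[of w r]
      by (meson holomorphic_on_subset holomorphic_on_imp_continuous_on subset_trans)
    then have "(\<lambda>x. theta3 (h x) (g x)) holomorphic_on ball w r"
      using holomorphic_uniform_limit[OF always_eventually ul] by simp
    then show ?thesis
      using r by (auto simp: holomorphic_on_open field_differentiable_def)
  qed
  then show ?thesis
    by (meson field_differentiable_at_within holomorphic_on_def)
qed

section \<open>Poisson summation for Gaussians\<close>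

text \<open>The M-test makes the finite partial sums converge uniformly along the net of finite
  sets, and uniform limits commute with integration over a bounded interval.\<close>

lemma has_sum_integral_of_dominated:
  fixes f :: "'i \<Rightarrow> real \<Rightarrow> complex"
  assumes cont: "\<And>n. continuous_on {a..b} (f n)"
    and le: "\<And>n x. x \<in> {a..b} \<Longrightarrow> norm (f n x) \<le> M n" and M: "M summable_on UNIV"
  shows "((\<lambda>n. integral {a..b} (f n)) has_sum integral {a..b} (\<lambda>x. \<Sum>\<^sub>\<infinity>n. f n x)) UNIV"
proof -
  have "uniform_limit {a..b} (\<lambda>X x. \<Sum>n\<in>X. f n x) (\<lambda>x. \<Sum>\<^sub>\<infinity>n. f n x) (finite_subsets_at_top UNIV)"
    by (rule Weierstrass_m_test_general[OF _ M]) (use le in auto)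
  then obtain I J where I: "\<And>X. ((\<lambda>x. \<Sum>n\<in>X. f n x) has_integral I X) {a..b}"
      and J: "((\<lambda>x. \<Sum>\<^sub>\<infinity>n. f n x) has_integral J) {a..b}"
      and lim: "(I \<longlongrightarrow> J) (finite_subsets_at_top UNIV)"
    by (rule uniform_limit_integral) (auto intro!: continuous_intros cont)
  have "I X = (\<Sum>n\<in>X. integral {a..b} (f n))" if "finite X" for X
  proof -
    have "I X = integral {a..b} (\<lambda>x. \<Sum>n\<in>X. f n x)" using I[of X] by (simp add: integral_unique)
    also have "\<dots> = (\<Sum>n\<in>X. integral {a..b} (f n))"
      using that cont by (intro integral_sum integrable_continuous_real) auto
    finally show ?thesis .
  qed
  then have "\<forall>\<^sub>F X in finite_subsets_at_top UNIV. I X = (\<Sum>n\<in>X. integral {a..b} (f n))"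
    by (intro eventually_finite_subsets_at_top_weakI)
  then have "((\<lambda>X. \<Sum>n\<in>X. integral {a..b} (f n)) \<longlongrightarrow> J) (finite_subsets_at_top UNIV)"
    using lim tendsto_cong by force
  then show ?thesis
    using J by (simp add: has_sum_def integral_unique)
qed

text \<open>Rescaling the variable turns the Gaussian into the standard normal density, whose
  characteristic function is known.\<close>

lemma integrable_gaussian_cis:
  assumes "t > 0"
  shows "integrable lborel (\<lambda>x. complex_of_real (exp (- pi * t * x\<^sup>2)) * cis (2 * pi * \<xi> * x))"
    and "integral\<^sup>L lborel (\<lambda>x. complex_of_real (exp (- pi * t * x\<^sup>2)) * cis (2 * pi * \<xi> * x))
      = of_real (exp (- pi * \<xi>\<^sup>2 / t) / sqrt t)"
proof -
  let ?f = "\<lambda>x. complex_of_real (exp (- pi * t * x\<^sup>2)) * cis (2 * pi * \<xi> * x)"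
  \<comment> \<open>Chosen so that pi t (c x)^2 = x^2 / 2; then \<open>s\<close> is the frequency
    seen after rescaling.\<close>
  define c where "c = 1 / sqrt (2 * pi * t)"
  define s where "s = 2 * pi * \<xi> * c"
  have c: "c > 0" "c\<^sup>2 = 1 / (2 * pi * t)" using assms by (auto simp: c_def power_divide)
  have eq: "?f (0 + c * x) = sqrt (2 * pi) *\<^sub>R (std_normal_density x *\<^sub>R cis (s * x))" for x
  proof -
    have "pi * t * (c * x)\<^sup>2 = x\<^sup>2 / 2" using assms c by (simp add: power_mult_distrib)
    then show ?thesis
      by (simp add: std_normal_density_def s_def scaleR_conv_of_real mult_ac)
  qed
  have "integrable lborel (\<lambda>x. std_normal_density x *\<^sub>R cis (s * x))"
    by (rule Bochner_Integration.integrable_bound[where f=std_normal_density])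
       (auto simp: cis_conv_exp)
  then have "integrable lborel (\<lambda>x. ?f (0 + c * x))"
    unfolding eq by (rule integrable_scaleR_right)
  then show "integrable lborel ?f"
    using c by (subst (asm) lborel_integrable_real_affine_iff) auto
  have char: "integral\<^sup>L lborel (\<lambda>x. std_normal_density x *\<^sub>R cis (s * x)) = of_real (exp (- s\<^sup>2 / 2))"
  proof -
    have "integral\<^sup>L std_normal_distribution (\<lambda>x. cis (s * x)) = of_real (exp (- s\<^sup>2 / 2))"
      using fun_cong[OF char_std_normal_distribution, of s] by (simp add: char_def cis_conv_exp)
    then show ?thesis by (subst (asm) integral_density) (auto simp: cis_conv_exp)
  qed
  have "integral\<^sup>L lborel ?f = \<bar>c\<bar> *\<^sub>R (\<integral>x. ?f (0 + c * x) \<partial>lborel)"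
    using c by (intro lborel_integral_real_affine) auto
  also have "\<dots> = of_real (c * sqrt (2 * pi) * exp (- s\<^sup>2 / 2))"
    unfolding eq integral_scaleR_right char using c by (simp add: scaleR_conv_of_real)
  also have "c * sqrt (2 * pi) = 1 / sqrt t"
    using assms by (simp add: c_def real_sqrt_mult)
  also have "- s\<^sup>2 / 2 = - pi * \<xi>\<^sup>2 / t"
    using assms by (simp add: s_def power_mult_distrib c(2)) (simp add: power2_eq_square)
  finally show "integral\<^sup>L lborel ?f = of_real (exp (- pi * \<xi>\<^sup>2 / t) / sqrt t)" by simp
qed

text \<open>Dominated convergence links the Lebesgue integral over the line with gauge integrals
  over bounded intervals.\<close>

lemma tendsto_integral_symmetric_interval:
  fixes f :: "real \<Rightarrow> 'a::euclidean_space"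
  assumes f: "integrable lborel f"
  shows "(\<lambda>N. integral {-real N..real N} f) \<longlonglongrightarrow> integral\<^sup>L lborel f"
proof -
  have meas: "f \<in> borel_measurable lborel" using f by auto
  have "(\<lambda>N. integral\<^sup>L lborel (\<lambda>x. indicator {-real N..real N} x *\<^sub>R f x)) \<longlonglongrightarrow> integral\<^sup>L lborel f"
  proof (rule integral_dominated_convergence[where w="\<lambda>x. norm (f x)"])
    show "AE x in lborel. (\<lambda>N. indicator {-real N..real N} x *\<^sub>R f x) \<longlonglongrightarrow> f x"
    proof (intro always_eventually allI)
      fix x
      obtain N0 :: nat where "\<bar>x\<bar> \<le> real N0" using real_arch_simple by blast
      then have "\<forall>N\<ge>N0. indicator {-real N..real N} x *\<^sub>R f x = f x"
        by (auto simp: indicator_def)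
      then show "(\<lambda>N. indicator {-real N..real N} x *\<^sub>R f x) \<longlonglongrightarrow> f x"
        by (intro tendsto_eventually) (auto simp: eventually_sequentially)
    qed
  qed (use f meas in \<open>auto simp: indicator_def\<close>)
  moreover have "integral\<^sup>L lborel (\<lambda>x. indicator {-real N..real N} x *\<^sub>R f x) = integral {-real N..real N} f" for N
  proof -
    have "set_integrable lborel {-real N..real N} f"
      unfolding set_integrable_def using f by (intro integrable_mult_indicator) auto
    from set_borel_integral_eq_integral(2)[OF this] show ?thesis
      by (simp add: set_lebesgue_integral_def)
  qed
  ultimately show ?thesis by simp
qed

text \<open>The half-open index range lists the left endpoints of the 2N unit intervals that tile
  [-N, N].\<close>

lemma sum_integral_unit_intervals:
  fixes f :: "real \<Rightarrow> 'a::banach"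
  assumes cont: "continuous_on UNIV f"
  shows "(\<Sum>n\<in>{-int N..<int N}. integral {0..1} (\<lambda>x. f (x + of_int n))) = integral {-real N..real N} f"
proof (induction N)
  case (Suc N)
  have int: "f integrable_on {a..b}" for a b
    using cont by (meson continuous_on_subset integrable_continuous_real subset_UNIV)
  have shift: "integral {0..1} (\<lambda>x. f (x + c)) = integral {c..c+1} f" for c
    using integral_shift_real_ivl[of c c "c + 1" f] by simp
  have set: "{-int (Suc N)..<int (Suc N)} = insert (-int N - 1) (insert (int N) {-int N..<int N})"
    by auto
  have "(\<Sum>n\<in>{-int (Suc N)..<int (Suc N)}. integral {0..1} (\<lambda>x. f (x + of_int n)))
     = integral {-real N - 1..-real N} f + (integral {real N..real N + 1} f + integral {-real N..real N} f)"
    unfolding set using Suc by (simp add: shift)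
  also have "\<dots> = integral {-real N - 1..-real N} f + integral {-real N..real N + 1} f"
    using Henstock_Kurzweil_Integration.integral_combine[OF _ _ int, of "-real N" "real N" "real N + 1"] by (simp add: add.commute)
  also have "\<dots> = integral {-real N - 1..real N + 1} f"
    using Henstock_Kurzweil_Integration.integral_combine[OF _ _ int, of "-real N - 1" "-real N" "real N + 1"] by simp
  also have "{-real N - 1..real N + 1} = {-real (Suc N)..real (Suc N)}" by simp
  finally show ?case .
qed simp

section \<open>Fourier coefficients of the theta series and of the periodized Gaussian\<close>

lemma theta3_add_pi: "theta3 (z + of_real pi) \<tau> = theta3 z \<tau>"
proof -
  have "theta_term (z + of_real pi) \<tau> k = theta_term z \<tau> k" for k
  proof -
    have "theta_term (z + of_real pi) \<tau> k = theta_term z \<tau> k * exp (2 * of_int k * of_real pi * \<i>)"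
      unfolding exp_add[symmetric] by (rule arg_cong[where f=exp]) (simp add: algebra_simps)
    also have "exp (2 * of_int k * of_real pi * \<i>) = 1"
      using exp_integer_2pi[of "of_int k"] by (simp add: mult_ac)
    finally show ?thesis by simp
  qed
  then show ?thesis by (simp add: theta3_eq)
qed

text \<open>Integrating termwise, orthogonality keeps only k = -j. The case j = 0 also shows that
  theta does not vanish identically.\<close>

lemma theta3_fourier_coefficient:
  fixes j :: int
  assumes "Im \<tau> > 0"
  shows "integral {0..1} (\<lambda>x. theta3 (of_real (pi * x)) \<tau> * cis (2 * pi * of_int j * x))
       = exp (of_real pi * \<i> * \<tau> * of_int j ^ 2)"
proof -
  let ?f = "\<lambda>k x. theta_term (of_real (pi * x)) \<tau> k * cis (2 * pi * of_int j * x)"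
  have f_eq: "?f k x = exp (of_real pi * \<i> * \<tau> * of_int k ^ 2) * cis (2 * pi * of_int (k + j) * x)" for k x
    by (simp add: cis_conv_exp exp_add[symmetric] algebra_simps)
  have int: "integral {0..1} (?f k) = (if k = - j then exp (of_real pi * \<i> * \<tau> * of_int j ^ 2) else 0)" for k
  proof -
    have "integral {0..1} (\<lambda>x. cis (2 * pi * of_int (k + j) * x)) = (if k = - j then 1 else 0)"
    proof (cases "k = - j")
      case False
      define c where "c = 2 * pi * of_int (k + j)"
      have "of_int (k + j) \<noteq> (0::real)" using False by (subst of_int_eq_0_iff) auto
      then have c: "c \<noteq> 0" by (simp add: c_def)
      have "((\<lambda>x. cis (c * x)) has_integral (cis (c * 1) / (\<i> * c) - cis (c * 0) / (\<i> * c))) {0..1}"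
      proof (rule fundamental_theorem_of_calculus)
        fix x :: real
        have "((\<lambda>z. exp (\<i> * c * z) / (\<i> * c)) has_field_derivative exp (\<i> * c * of_real x)) (at (of_real x))"
          using c by (auto intro!: derivative_eq_intros)
        then have "((\<lambda>x. exp (\<i> * c * of_real x) / (\<i> * c)) has_vector_derivative exp (\<i> * c * of_real x)) (at x)"
          by (rule has_vector_derivative_real_field)
        then show "((\<lambda>x. cis (c * x) / (\<i> * c)) has_vector_derivative cis (c * x)) (at x within {0..1})"
          unfolding cis_conv_exp of_real_mult mult.assoc by (rule has_vector_derivative_at_within)
      qed simp
      moreover have "cis (c * 1) = 1"
        using cis_multiple_2pi[of "of_int (k + j)"] by (simp add: c_def)
      ultimately have "integral {0..1} (\<lambda>x. cis (c * x)) = 0" by (simp add: integral_unique)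
      then show ?thesis using False by (simp add: c_def)
    qed simp
    then show ?thesis
      unfolding f_eq integral_mult_right by simp
  qed
  have "((\<lambda>k. integral {0..1} (?f k)) has_sum integral {0..1} (\<lambda>x. \<Sum>\<^sub>\<infinity>k. ?f k x)) UNIV"
  proof (rule has_sum_integral_of_dominated)
    show "continuous_on {0..1} (?f k)" for k
      by (auto simp: cis_conv_exp intro!: continuous_intros)
    show "(\<lambda>k. exp ((2 * pi) * \<bar>of_int k\<bar> - (pi * Im \<tau>) * of_int k ^ 2)) summable_on UNIV"
      using assms by (intro summable_on_int_gaussian) auto
    fix k :: int and x :: real assume "x \<in> {0..1}"
    then have "norm (theta_term (of_real (pi * x)) \<tau> k)
        \<le> exp ((2 * pi) * \<bar>of_int k\<bar> - (pi * Im \<tau>) * of_int k ^ 2)"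
      by (intro norm_theta_term_le) (auto simp: norm_mult)
    then show "norm (?f k x) \<le> exp ((2 * pi) * \<bar>of_int k\<bar> - (pi * Im \<tau>) * of_int k ^ 2)"
      by (simp only: norm_mult norm_cis mult_1_right)
  qed
  also have "(\<lambda>x. \<Sum>\<^sub>\<infinity>k. ?f k x) = (\<lambda>x. theta3 (of_real (pi * x)) \<tau> * cis (2 * pi * of_int j * x))"
    by (simp only: theta3_eq infsum_cmult_left')
  finally have "((\<lambda>k. integral {0..1} (?f k)) has_sum
      integral {0..1} (\<lambda>x. theta3 (of_real (pi * x)) \<tau> * cis (2 * pi * of_int j * x))) UNIV" .
  moreover have "((\<lambda>k. integral {0..1} (?f k)) has_sum exp (of_real pi * \<i> * \<tau> * of_int j ^ 2)) UNIV"
    unfolding int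
    by (rule has_sum_finite_neutralI[where B="{-j}"]) auto
  ultimately show ?thesis by (rule has_sum_unique)
qed

text \<open>Expanding the square splits off the factor depending on x alone. This form yields the
  continuity of the periodized Gaussian and, later, the right-hand side of the inversion formula on
  the imaginary axis.\<close>

lemma periodized_gaussian_eq_theta3:
  fixes t x :: real
  shows "(\<Sum>\<^sub>\<infinity>n::int. complex_of_real (exp (- pi * t * (x + of_int n)\<^sup>2)))
    = exp (- of_real (pi * t * x\<^sup>2)) * theta3 (\<i> * of_real (pi * t * x)) (\<i> * of_real t)"
proof -
  have "complex_of_real (exp (- pi * t * (x + of_int n)\<^sup>2))
     = exp (- of_real (pi * t * x\<^sup>2)) * theta_term (\<i> * of_real (pi * t * x)) (\<i> * of_real t) n" for n
    unfolding exp_add[symmetric] exp_of_real[symmetric]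
    by (rule arg_cong[where f=exp]) (simp add: power2_eq_square algebra_simps)
  then show ?thesis by (simp only: theta3_eq infsum_cmult_right')
qed

text \<open>Allows an unordered sum over the integers to be computed along symmetric partial sums,
  which match integrals over [-N, N].\<close>

lemma filterlim_symmetric_int_intervals:
  "filterlim (\<lambda>N. {-int N..<int N}) (finite_subsets_at_top UNIV) sequentially"
  unfolding filterlim_finite_subsets_at_top
proof (intro allI impI)
  fix X :: "int set" assume "finite X \<and> X \<subseteq> UNIV"
  then have "finite X" by blast
  define m where "m = Max (insert 0 (abs ` X))"
  have "X \<subseteq> {-int N..<int N}" if "N \<ge> nat (m + 1)" for N
  proof
    fix k assume "k \<in> X"
    then have "\<bar>k\<bar> \<le> m" unfolding m_def using \<open>finite X\<close> by (intro Max_ge) auto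
    then show "k \<in> {-int N..<int N}" using that by auto
  qed
  then show "\<forall>\<^sub>F N in sequentially. finite {-int N..<int N} \<and> X \<subseteq> {-int N..<int N} \<and> {-int N..<int N} \<subseteq> UNIV"
    by (auto simp: eventually_sequentially)
qed

text \<open>The character is invariant under integer shifts and so moves inside the sum. The
  integrals of the translates over [0, 1] then assemble to an integral over the line, the Fourier
  transform of the Gaussian at j.\<close>

lemma periodized_gaussian_fourier_coefficient:
  fixes j :: int
  assumes "t > 0"
  shows "integral {0..1} (\<lambda>x. (\<Sum>\<^sub>\<infinity>n::int. complex_of_real (exp (- pi * t * (x + of_int n)\<^sup>2))) * cis (2 * pi * of_int j * x))
       = of_real (exp (- pi * (of_int j)\<^sup>2 / t) / sqrt t)"
proof -
  define f where "f u = complex_of_real (exp (- pi * t * u\<^sup>2)) * cis (2 * pi * of_int j * u)" for u :: real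
  have shift: "f (x + of_int n) = complex_of_real (exp (- pi * t * (x + of_int n)\<^sup>2)) * cis (2 * pi * of_int j * x)"
    for x and n :: int
  proof -
    have "cis (2 * pi * of_int j * (x + of_int n)) = cis (2 * pi * of_int j * x) * cis (2 * pi * of_int (j * n))"
      by (simp add: cis_mult algebra_simps)
    also have "cis (2 * pi * of_int (j * n)) = 1" by (rule cis_multiple_2pi[OF Ints_of_int])
    finally show ?thesis by (simp add: f_def)
  qed
  have "continuous_on UNIV f"
    unfolding f_def by (auto simp: cis_conv_exp intro!: continuous_intros)
  have "((\<lambda>n::int. integral {0..1} (\<lambda>x. f (x + of_int n))) has_sum integral {0..1} (\<lambda>x. \<Sum>\<^sub>\<infinity>n::int. f (x + of_int n))) UNIV"
  proof (rule has_sum_integral_of_dominated)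
    show "continuous_on {0..1} (\<lambda>x. f (x + of_int n))" for n :: int
      unfolding f_def by (auto simp: cis_conv_exp intro!: continuous_intros)
    show "(\<lambda>n::int. exp ((2 * pi * t) * \<bar>of_int n\<bar> - (pi * t) * of_int n ^ 2)) summable_on UNIV"
      using assms by (intro summable_on_int_gaussian) auto
    fix n :: int and x :: real assume x: "x \<in> {0..1}"
    \<comment> \<open>For x in [0, 1] this gives (x + n)^2 \<ge> n^2 - 2|n|, a bound free of
      x.\<close>
    have "- (x * of_int n) \<le> \<bar>x * of_int n\<bar>" by (rule abs_ge_minus_self)
    also have "\<dots> \<le> 1 * \<bar>of_int n\<bar>" unfolding abs_mult using x by (intro mult_right_mono) auto
    finally have "(of_int n)\<^sup>2 - 2 * \<bar>of_int n\<bar> \<le> (x + of_int n)\<^sup>2"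
      unfolding power2_sum using zero_le_power2[of x] by linarith
    then have "(pi * t) * ((of_int n)\<^sup>2 - 2 * \<bar>of_int n\<bar>) \<le> (pi * t) * (x + of_int n)\<^sup>2"
      using assms by (intro mult_left_mono) auto
    then show "norm (f (x + of_int n)) \<le> exp ((2 * pi * t) * \<bar>of_int n\<bar> - (pi * t) * of_int n ^ 2)"
      unfolding f_def norm_mult norm_cis by (simp add: algebra_simps)
  qed
  then have "(\<lambda>N. \<Sum>n\<in>{-int N..<int N}. integral {0..1} (\<lambda>x. f (x + of_int n)))
      \<longlonglongrightarrow> integral {0..1} (\<lambda>x. \<Sum>\<^sub>\<infinity>n::int. f (x + of_int n))"
    unfolding has_sum_def using filterlim_compose filterlim_symmetric_int_intervals by blast
  moreover have "(\<lambda>N. \<Sum>n\<in>{-int N..<int N}. integral {0..1} (\<lambda>x. f (x + of_int n)))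
      \<longlonglongrightarrow> of_real (exp (- pi * (of_int j)\<^sup>2 / t) / sqrt t)"
    unfolding sum_integral_unit_intervals[OF \<open>continuous_on UNIV f\<close>]
    using tendsto_integral_symmetric_interval[OF integrable_gaussian_cis(1)[OF assms, of "of_int j"]]
    unfolding integrable_gaussian_cis(2)[OF assms] f_def .
  ultimately have "integral {0..1} (\<lambda>x. \<Sum>\<^sub>\<infinity>n::int. f (x + of_int n)) = of_real (exp (- pi * (of_int j)\<^sup>2 / t) / sqrt t)"
    by (rule LIMSEQ_unique)
  then show ?thesis by (simp only: shift infsum_cmult_left')
qed

lemma periodized_gaussian_poisson:
  fixes t x :: real
  assumes "t > 0"
  shows "(\<Sum>\<^sub>\<infinity>n::int. complex_of_real (exp (- pi * t * (x + of_int n)\<^sup>2)))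
    = theta3 (of_real (pi * x)) (\<i> / of_real t) / sqrt t"
proof -
  define B where "B x = (\<Sum>\<^sub>\<infinity>n::int. complex_of_real (exp (- pi * t * (x + of_int n)\<^sup>2)))" for x
  define A where "A x = theta3 (of_real (pi * x)) (\<i> / of_real t) / sqrt t" for x :: real
  have cont_theta: "continuous_on UNIV (\<lambda>x::real. theta3 (c * of_real x) \<sigma>)" if "Im \<sigma> > 0" for c \<sigma>
  proof -
    have "(\<lambda>w. theta3 (c * w) \<sigma>) holomorphic_on UNIV"
      by (intro holomorphic_theta3 holomorphic_intros) (use that in auto)
    then have "continuous_on UNIV (\<lambda>w. theta3 (c * w) \<sigma>)" by (rule holomorphic_on_imp_continuous_on)
    from continuous_on_compose2[OF this, of UNIV of_real] show ?thesis
      by (auto intro!: continuous_intros)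
  qed
  have im: "Im (\<i> / complex_of_real t) > 0" "Im (\<i> * complex_of_real t) > 0" using assms by (auto simp: Im_divide_of_real)
  have A_cont: "continuous_on UNIV A"
    unfolding A_def using cont_theta[OF im(1), of "of_real pi"] assms
    by (intro continuous_intros) auto
  have B_cont: "continuous_on UNIV B"
    unfolding B_def periodized_gaussian_eq_theta3
    using cont_theta[OF im(2), of "\<i> * of_real (pi * t)"]
    by (intro continuous_intros) (auto simp: mult.assoc)
  have A_per: "A (x + 1) = A x" for x
    using theta3_add_pi[of "of_real (pi * x)"] by (simp add: A_def distrib_left)
  have B_per: "B (x + 1) = B x" for x
    unfolding B_def
    by (rule infsum_reindex_bij_witness[where j="\<lambda>n. n + 1" and i="\<lambda>n. n - 1"]) (auto simp: algebra_simps)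
  have intA: "(\<lambda>x. A x * cis (2 * pi * of_int j * x)) integrable_on {0..1}" for j :: int
    by (intro integrable_continuous_real continuous_intros continuous_on_subset[OF A_cont]) auto
  have intB: "(\<lambda>x. B x * cis (2 * pi * of_int j * x)) integrable_on {0..1}" for j :: int
    by (intro integrable_continuous_real continuous_intros continuous_on_subset[OF B_cont]) auto
  have "B x - A x = 0"
  proof (rule fourier_coefficients_zero_imp_zero)
    show "continuous_on UNIV (\<lambda>x. B x - A x)" by (intro continuous_intros A_cont B_cont)
    show "B (x + 1) - A (x + 1) = B x - A x" for x using A_per B_per by simp
    fix j :: int
    have "integral {0..1} (\<lambda>x. A x * cis (2 * pi * of_int j * x))
        = integral {0..1} (\<lambda>x. theta3 (of_real (pi * x)) (\<i> / of_real t) * cis (2 * pi * of_int j * x)) / sqrt t"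
      by (simp add: A_def)
    also have "\<dots> = exp (of_real pi * \<i> * (\<i> / of_real t) * of_int j ^ 2) / sqrt t"
      by (simp only: theta3_fourier_coefficient[OF im(1)])
    also have "of_real pi * \<i> * (\<i> / of_real t) * of_int j ^ 2 = complex_of_real (- pi * (of_int j)\<^sup>2 / t)"
      by (simp add: mult.assoc)
    also have "exp \<dots> / sqrt t = complex_of_real (exp (- pi * (of_int j)\<^sup>2 / t) / sqrt t)"
      by (simp only: of_real_divide exp_of_real[symmetric])
    also have "\<dots> = integral {0..1} (\<lambda>x. B x * cis (2 * pi * of_int j * x))"
      unfolding B_def using periodized_gaussian_fourier_coefficient[OF assms] by simp
    finally show "integral {0..1} (\<lambda>x. (B x - A x) * cis (2 * pi * of_int j * x)) = 0"
      by (simp add: left_diff_distrib integral_diff intA intB)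
  qed
  then show ?thesis by (simp add: A_def B_def)
qed

section \<open>Jacobi's inversion formula\<close>

lemma Im_uminus_inverse_pos: "Im \<tau> > 0 \<Longrightarrow> Im (- 1 / \<tau>) > 0"
  by (simp add: Im_divide) (smt (verit) divide_pos_pos sum_power2_gt_zero_iff)

lemma zero_islimpt_Reals: "(0::complex) islimpt \<real>"
proof (rule islimptI)
  fix T :: "complex set" assume "0 \<in> T" "open T"
  then obtain e where "e > 0" "ball 0 e \<subseteq> T" using open_contains_ball by blast
  then have "complex_of_real (e/2) \<in> T" by (auto simp: subset_iff)
  then show "\<exists>y\<in>\<real>. y \<in> T \<and> y \<noteq> 0" using \<open>e > 0\<close> by (intro bexI[of _ "of_real (e/2)"]) auto
qed

text \<open>The periodization identity gives the imaginary axis and real arguments; both variables are then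
  freed by analytic continuation, first the modulus and then the argument.\<close>

theorem theta3_inversion:
  assumes "Im \<tau> > 0"
  shows "theta3 (z / \<tau>) (- 1 / \<tau>) = (- \<i> * \<tau>) powr (1/2) * exp (\<i> * z\<^sup>2 / (of_real pi * \<tau>)) * theta3 z \<tau>"
proof -
  \<comment> \<open>The defect of the formula at z = pi \<tau> x. In this scaling the left theta has
    argument pi x, free of \<tau>, so real x and \<tau> = i t give exactly the Poisson
    identity.\<close>
  define H where "H x \<tau> = theta3 (of_real pi * x) (- 1 / \<tau>)
      - (- \<i> * \<tau>) powr (1/2) * exp (of_real pi * \<i> * \<tau> * x\<^sup>2) * theta3 (of_real pi * \<tau> * x) \<tau>" for x \<tau>
  have H_imag: "H (of_real x) (\<i> * of_real t) = 0" if "t > 0" for x t :: real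
  proof -
    have "theta3 (of_real (pi * x)) (\<i> / of_real t) = sqrt t *
       (exp (- of_real (pi * t * x\<^sup>2)) * theta3 (\<i> * of_real (pi * t * x)) (\<i> * of_real t))"
      using periodized_gaussian_poisson[OF that, of x] that
      unfolding periodized_gaussian_eq_theta3 by (simp add: field_simps)
    moreover have "- 1 / (\<i> * of_real t) = \<i> / complex_of_real t"
      using that by (simp add: field_simps)
    moreover have "(- \<i> * (\<i> * of_real t)) powr (1/2) = complex_of_real (sqrt t)"
      using that powr_of_real[of t "1/2"] by (simp add: powr_half_sqrt)
    ultimately show ?thesis
      unfolding H_def by (simp add: mult_ac)
  qed
  have H_real: "H (of_real x) \<tau> = 0" if \<tau>: "Im \<tau> > 0" for x :: real and \<tau>
  proof (rule analytic_continuation[where f="H (of_real x)" and S="{\<tau>. Im \<tau> > 0}"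
        and U="(\<lambda>t. \<i> * complex_of_real t) ` {0<..}" and \<xi>=\<i>])
    show "H (of_real x) holomorphic_on {\<tau>. Im \<tau> > 0}"
    proof -
      let ?S = "{\<tau>. Im \<tau> > 0}"
      have op: "open ?S" by (rule open_halfspace_Im_gt)
      have 1: "(\<lambda>\<tau>. theta3 (of_real pi * of_real x) (- 1 / \<tau>)) holomorphic_on ?S"
      proof (rule holomorphic_theta3[OF op])
        show "(\<lambda>\<tau>. - 1 / \<tau>) holomorphic_on ?S" by (intro holomorphic_intros) auto
      qed (use Im_uminus_inverse_pos in \<open>auto intro: holomorphic_intros\<close>)
      have 2: "(\<lambda>\<tau>. theta3 (of_real pi * \<tau> * of_real x) \<tau>) holomorphic_on ?S"
        by (rule holomorphic_theta3[OF op]) (auto intro!: holomorphic_intros)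
      \<comment> \<open>In the upper half-plane - i \<tau> has positive real part, so the principal
        branch stays off its cut.\<close>
      have "- \<i> * \<tau> \<notin> \<real>\<^sub>\<le>\<^sub>0" if "\<tau> \<in> ?S" for \<tau>
        using that by (auto simp: complex_nonpos_Reals_iff)
      then have 3: "(\<lambda>\<tau>. (- \<i> * \<tau>) powr (1/2)) holomorphic_on ?S"
        by (intro holomorphic_intros) auto
      show ?thesis
        unfolding H_def by (intro holomorphic_on_diff holomorphic_on_mult 1 2 3) (intro holomorphic_intros)
    qed
    show "connected {\<tau>. Im \<tau> > 0}" by (intro convex_connected convex_halfspace_Im_gt)
    show "\<i> islimpt (\<lambda>t. \<i> * complex_of_real t) ` {0<..}"
    proof (rule islimptI)
      fix T assume "\<i> \<in> T" "open T"
      then obtain e where e: "e > 0" "ball \<i> e \<subseteq> T" using open_contains_ball by blast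
      have "dist \<i> (\<i> * complex_of_real (1 + e/2)) < e"
        using e by (simp add: dist_norm algebra_simps norm_mult)
      then have "\<i> * complex_of_real (1 + e/2) \<in> T" using e by auto
      then show "\<exists>y\<in>(\<lambda>t. \<i> * complex_of_real t) ` {0<..}. y \<in> T \<and> y \<noteq> \<i>"
        using e by (intro bexI[of _ "\<i> * of_real (1 + e/2)"]) (auto simp: complex_eq_iff)
    qed
  qed (use \<tau> H_imag open_halfspace_Im_gt in auto)
  have "H x \<tau> = 0" for x
  proof (rule analytic_continuation[where f="\<lambda>x. H x \<tau>" and S=UNIV and U=\<real> and \<xi>=0])
    show "(\<lambda>x. H x \<tau>) holomorphic_on UNIV"
    proof -
      have "(\<lambda>x. theta3 (of_real pi * x) (- 1 / \<tau>)) holomorphic_on UNIV"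
        "(\<lambda>x. theta3 (of_real pi * \<tau> * x) \<tau>) holomorphic_on UNIV"
        using assms Im_uminus_inverse_pos[OF assms]
        by (auto intro!: holomorphic_theta3 holomorphic_intros simp del: Im_divide)
      then show ?thesis unfolding H_def by (intro holomorphic_intros)
    qed
  qed (use zero_islimpt_Reals H_real[OF assms] in \<open>auto elim!: Reals_cases\<close>)
  from this[of "z / (of_real pi * \<tau>)"] assms show ?thesis
    by (cases "\<tau> = 0") (auto simp: H_def power_divide power2_eq_square)
qed

section \<open>Sums over integer lattices\<close>

text \<open>Stands for the integer vectors indexed by \<open>A\<close>; the value 0 outside
  \<open>A\<close> makes the encoding by total functions unique, so that sums count each vector
  once.\<close>

definition int_lattice :: "'a set \<Rightarrow> ('a \<Rightarrow> int) set" where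
  "int_lattice A = {r. \<forall>j. j \<notin> A \<longrightarrow> r j = 0}"

text \<open>Translation along the diagonal (1, ..., 1); the value 0 off \<open>{1..n}\<close> keeps
  the result in \<open>int_lattice {1..n}\<close>.\<close>

definition shift_vec :: "nat \<Rightarrow> int \<Rightarrow> (nat \<Rightarrow> int) \<Rightarrow> nat \<Rightarrow> int" where
  "shift_vec n c r = (\<lambda>j. if j \<in> {1..n} then r j + c else 0)"

lemma norm_summable_on_times:
  fixes f :: "'a \<Rightarrow> complex" and g :: "'b \<Rightarrow> complex"
  assumes f: "(\<lambda>x. norm (f x)) summable_on A" and g: "(\<lambda>y. norm (g y)) summable_on B"
  shows "(\<lambda>(x, y). norm (f x * g y)) summable_on A \<times> B"
proof -
  have "(\<lambda>p. norm (f (fst p) * g (snd p))) summable_on A \<times> B"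
    unfolding Infinite_Sum.abs_summable_on_Sigma_iff
  proof (intro conjI ballI)
    show "(\<lambda>y. norm (f (fst (x, y)) * g (snd (x, y)))) summable_on B" for x
      using g by (simp add: norm_mult summable_on_cmult_right)
    show "(\<lambda>x. norm (\<Sum>\<^sub>\<infinity>y\<in>B. norm (f (fst (x, y)) * g (snd (x, y))))) summable_on A"
      using f by (simp add: norm_mult infsum_cmult_right' abs_mult summable_on_cmult_left)
  qed
  then show ?thesis by (simp add: case_prod_unfold)
qed

text \<open>Induction splits off one coordinate. Absolute summability and the value are proved
  together, because the iterated summation in the step needs the former for the smaller index
  set.\<close>

lemma
  fixes f :: "'a \<Rightarrow> int \<Rightarrow> complex"
  assumes "finite A" and "\<And>j. j \<in> A \<Longrightarrow> (\<lambda>k. norm (f j k)) summable_on UNIV"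
  shows norm_summable_on_int_lattice_prod:
      "(\<lambda>r. norm (\<Prod>j\<in>A. f j (r j))) summable_on int_lattice A"
    and infsum_int_lattice_prod:
      "(\<Sum>\<^sub>\<infinity>r\<in>int_lattice A. \<Prod>j\<in>A. f j (r j)) = (\<Prod>j\<in>A. \<Sum>\<^sub>\<infinity>k. f j k)"
proof -
  let ?P = "\<lambda>B r. \<Prod>j\<in>B. f j (r j)"
  have "(\<lambda>r. norm (?P A r)) summable_on int_lattice A \<and>
    (\<Sum>\<^sub>\<infinity>r\<in>int_lattice A. ?P A r) = (\<Prod>j\<in>A. \<Sum>\<^sub>\<infinity>k. f j k)"
    using assms
  proof (induction A rule: finite_induct)
    case empty
    have "int_lattice ({} :: 'a set) = {\<lambda>_. 0}" by (auto simp: int_lattice_def)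
    then show ?case by simp
  next
    case (insert a A)
    have bij: "bij_betw (\<lambda>(r, k). r(a := k)) (int_lattice A \<times> UNIV) (int_lattice (insert a A))"
      by (rule bij_betw_byWitness[where f'="\<lambda>r. (r(a := 0), r a)"])
         (use insert.hyps in \<open>auto simp: int_lattice_def\<close>)
    have P: "?P (insert a A) (r(a := k)) = ?P A r * f a k" for r k
    proof -
      have "?P A (r(a := k)) = ?P A r" using insert.hyps by (intro prod.cong) auto
      then show ?thesis using insert.hyps by simp
  qed
  have sum: "(\<lambda>(r, k). norm (?P A r * f a k)) summable_on int_lattice A \<times> UNIV"
    using insert by (intro norm_summable_on_times) auto
  have "(\<lambda>p. norm (?P (insert a A) ((\<lambda>(r, k). r(a := k)) p))) summable_on int_lattice A \<times> UNIV"
    using sum by (simp only: case_prod_unfold P)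
  then have 1: "(\<lambda>r. norm (?P (insert a A) r)) summable_on int_lattice (insert a A)"
    by (subst (asm) summable_on_reindex_bij_betw[OF bij, of "\<lambda>r. norm (?P (insert a A) r)"])
  have "(\<Sum>\<^sub>\<infinity>r\<in>int_lattice (insert a A). ?P (insert a A) r)
      = (\<Sum>\<^sub>\<infinity>p\<in>int_lattice A \<times> UNIV. ?P (insert a A) ((\<lambda>(r, k). r(a := k)) p))"
    by (rule infsum_reindex_bij_betw[OF bij, symmetric])
  also have "\<dots> = (\<Sum>\<^sub>\<infinity>(r, k)\<in>int_lattice A \<times> UNIV. ?P A r * f a k)"
    by (simp only: case_prod_unfold P)
  also have "\<dots> = (\<Sum>\<^sub>\<infinity>r\<in>int_lattice A. \<Sum>\<^sub>\<infinity>k. ?P A r * f a k)"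
  proof (rule infsum_Sigma'_banach[symmetric])
    show "(\<lambda>(r, k). ?P A r * f a k) summable_on int_lattice A \<times> UNIV"
      using sum abs_summable_summable[of "\<lambda>(r, k). ?P A r * f a k"] by (simp only: case_prod_unfold)
  qed
  also have "\<dots> = (\<Sum>\<^sub>\<infinity>r\<in>int_lattice A. ?P A r) * (\<Sum>\<^sub>\<infinity>k. f a k)"
    by (simp add: infsum_cmult_right' infsum_cmult_left')
  also have "\<dots> = (\<Prod>j\<in>insert a A. \<Sum>\<^sub>\<infinity>k. f j k)"
    using insert by (simp add: mult.commute)
  finally show ?case using 1 by blast
  qed
  then show "(\<lambda>r. norm (?P A r)) summable_on int_lattice A"
    "(\<Sum>\<^sub>\<infinity>r\<in>int_lattice A. ?P A r) = (\<Prod>j\<in>A. \<Sum>\<^sub>\<infinity>k. f j k)"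
    by blast+
qed

lemma sum_shift_vec:
  fixes r :: "nat \<Rightarrow> int"
  shows "(\<Sum>j=1..n. shift_vec n c r j) = (\<Sum>j=1..n. r j) + int n * c"
  by (simp add: shift_vec_def sum.distrib)

text \<open>Division with remainder of the coordinate sum by d n: a diagonal shift by d changes that
  sum by d n, so the quotient is t and the remainder \<kappa>. The direct expansion takes d = 1, the
  expansion after inversion d = m.\<close>

lemma infsum_int_lattice_decompose:
  fixes f :: "(nat \<Rightarrow> int) \<Rightarrow> complex"
  assumes "n > 0" "d > 0" and f: "f summable_on int_lattice {1..n}"
  shows "infsum f (int_lattice {1..n})
    = (\<Sum>\<kappa><d * n. \<Sum>\<^sub>\<infinity>r\<in>int_vecs n (int \<kappa>). \<Sum>\<^sub>\<infinity>t::int. f (shift_vec n (int d * t) r))"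
proof -
  define M where "M = int d * int n"
  have M: "M > 0" using assms by (simp add: M_def)
  let ?S = "SIGMA \<kappa>:{..<d * n}. int_vecs n (int \<kappa>) \<times> (UNIV :: int set)"
  let ?s = "\<lambda>r::nat \<Rightarrow> int. \<Sum>j=1..n. r j"
  let ?h = "\<lambda>(\<kappa>::nat, r, t). shift_vec n (int d * t) r"
  have sum_h: "?s (shift_vec n (int d * t) r) = int \<kappa> + M * t" if "r \<in> int_vecs n (int \<kappa>)" for r \<kappa> t
    using that unfolding sum_shift_vec M_def int_vecs_def by simp
  have bij: "bij_betw ?h ?S (int_lattice {1..n})"
  proof (rule bij_betw_byWitness[where f'="\<lambda>r. (nat (?s r mod M), shift_vec n (- int d * (?s r div M)) r, ?s r div M)"])
    show "\<forall>p\<in>?S. (\<lambda>r. (nat (?s r mod M), shift_vec n (- int d * (?s r div M)) r, ?s r div M)) (?h p) = p"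
    proof
      fix p assume "p \<in> ?S"
      then obtain \<kappa> r t where p: "p = (\<kappa>, r, t)" and \<kappa>: "\<kappa> < d * n" and r: "r \<in> int_vecs n (int \<kappa>)"
        by auto
      have lt: "int \<kappa> < M" using \<kappa> unfolding M_def by (metis of_nat_less_iff of_nat_mult)
      have "?s (?h (\<kappa>, r, t)) = int \<kappa> + M * t" using sum_h[OF r] by simp
      moreover have "(int \<kappa> + M * t) div M = t" "(int \<kappa> + M * t) mod M = int \<kappa>" using lt M by auto
      moreover have "shift_vec n (- int d * t) (?h (\<kappa>, r, t)) = r"
        using r by (auto simp: shift_vec_def int_vecs_def)
      ultimately show "(\<lambda>r. (nat (?s r mod M), shift_vec n (- int d * (?s r div M)) r, ?s r div M)) (?h p) = p"
        by (simp only: p nat_int)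
    qed
    show "\<forall>r\<in>int_lattice {1..n}. ?h (nat (?s r mod M), shift_vec n (- int d * (?s r div M)) r, ?s r div M) = r"
      by (auto simp: shift_vec_def int_lattice_def)
    show "?h ` ?S \<subseteq> int_lattice {1..n}" by (auto simp: shift_vec_def int_lattice_def)
    show "(\<lambda>r. (nat (?s r mod M), shift_vec n (- int d * (?s r div M)) r, ?s r div M)) ` int_lattice {1..n} \<subseteq> ?S"
    proof (rule image_subsetI)
      fix r :: "nat \<Rightarrow> int"
      have "?s (shift_vec n (- int d * (?s r div M)) r) = ?s r - M * (?s r div M)"
        unfolding sum_shift_vec M_def by simp
      also have "\<dots> = ?s r mod M" by (simp add: minus_mult_div_eq_mod)
      also have "\<dots> = int (nat (?s r mod M))" using M by simp
      finally have "shift_vec n (- int d * (?s r div M)) r \<in> int_vecs n (int (nat (?s r mod M)))"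
        by (auto simp: int_vecs_def shift_vec_def)
      moreover have "nat (?s r mod M) < d * n"
        using M pos_mod_bound[of M "?s r"] pos_mod_sign[of M "?s r"]
        by (simp add: nat_less_iff M_def)
      ultimately show "(nat (?s r mod M), shift_vec n (- int d * (?s r div M)) r, ?s r div M) \<in> ?S"
        by blast
    qed
  qed
  have summable: "(\<lambda>p. f (?h p)) summable_on ?S"
    using f by (subst summable_on_reindex_bij_betw[OF bij])
  have "infsum f (int_lattice {1..n}) = infsum (\<lambda>p. f (?h p)) ?S"
    by (rule infsum_reindex_bij_betw[OF bij, symmetric])
  also have "\<dots> = (\<Sum>\<^sub>\<infinity>\<kappa>\<in>{..<d * n}. \<Sum>\<^sub>\<infinity>p\<in>int_vecs n (int \<kappa>) \<times> UNIV. f (?h (\<kappa>, p)))"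
    by (rule infsum_Sigma_banach[OF summable, symmetric])
  also have "\<dots> = (\<Sum>\<kappa><d * n. \<Sum>\<^sub>\<infinity>p\<in>int_vecs n (int \<kappa>) \<times> UNIV. f (?h (\<kappa>, p)))"
    by (rule infsum_finite) simp
  also have "\<dots> = (\<Sum>\<kappa><d * n. \<Sum>\<^sub>\<infinity>r\<in>int_vecs n (int \<kappa>). \<Sum>\<^sub>\<infinity>t. f (?h (\<kappa>, r, t)))"
  proof (intro sum.cong refl)
    fix \<kappa> assume "\<kappa> \<in> {..<d * n}"
    have "(\<lambda>(\<kappa>, p). f (?h (\<kappa>, p))) summable_on ?S" using summable by (simp only: case_prod_unfold prod.collapse)
    then have "(\<lambda>p. f (?h (\<kappa>, p))) summable_on int_vecs n (int \<kappa>) \<times> UNIV"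
      using \<open>\<kappa> \<in> {..<d * n}\<close> by (rule summable_on_SigmaD1)
    then show "(\<Sum>\<^sub>\<infinity>p\<in>int_vecs n (int \<kappa>) \<times> UNIV. f (?h (\<kappa>, p)))
        = (\<Sum>\<^sub>\<infinity>r\<in>int_vecs n (int \<kappa>). \<Sum>\<^sub>\<infinity>t. f (?h (\<kappa>, r, t)))"
      by (rule infsum_Sigma_banach[symmetric])
  qed
  finally show ?thesis by simp
qed

text \<open>Every integer p is k - a - M t for exactly one pair: k is the residue of p + a modulo M
  and t the negated quotient. The offset a only permutes the classes.\<close>

lemma infsum_int_residue_classes:
  fixes g :: "int \<Rightarrow> complex"
  assumes "M > 0" and g: "g summable_on UNIV"
  shows "(\<Sum>k<M. \<Sum>\<^sub>\<infinity>t. g (int k - a - int M * t)) = infsum g UNIV"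
proof -
  let ?h = "\<lambda>(k::nat, t). int k - a - int M * t"
  have bij: "bij_betw ?h ({..<M} \<times> UNIV) UNIV"
  proof (rule bij_betw_byWitness[where f'="\<lambda>p. (nat ((p + a) mod int M), - ((p + a) div int M))"])
    show "\<forall>x\<in>{..<M} \<times> UNIV. (\<lambda>p. (nat ((p + a) mod int M), - ((p + a) div int M))) (?h x) = x"
    proof
      fix x assume "x \<in> {..<M} \<times> (UNIV :: int set)"
      then obtain k t where x: "x = (k, t)" and "k < M" by auto
      have "?h (k, t) + a = int k + int M * (- t)" by simp
      moreover have "(int k + int M * (- t)) div int M = - t"
        using \<open>k < M\<close> by (subst div_mult_self2) auto
      moreover have "(int k + int M * (- t)) mod int M = int k"
        unfolding mod_mult_self2 using \<open>k < M\<close> by simp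
      ultimately show "(\<lambda>p. (nat ((p + a) mod int M), - ((p + a) div int M))) (?h x) = x"
        by (simp only: x nat_int minus_minus)
    qed
    show "\<forall>p\<in>UNIV. ?h (nat ((p + a) mod int M), - ((p + a) div int M)) = p"
      using assms by (auto simp: algebra_simps) 
    show "(\<lambda>p. (nat ((p + a) mod int M), - ((p + a) div int M))) ` UNIV \<subseteq> {..<M} \<times> UNIV"
      using assms by (auto simp: nat_less_iff)
  qed auto
  have summable: "(\<lambda>p. g (?h p)) summable_on {..<M} \<times> UNIV"
    using g by (subst summable_on_reindex_bij_betw[OF bij])
  have "infsum g UNIV = infsum (\<lambda>p. g (?h p)) ({..<M} \<times> UNIV)"
    by (rule infsum_reindex_bij_betw[OF bij, symmetric])
  also have "\<dots> = (\<Sum>\<^sub>\<infinity>k\<in>{..<M}. \<Sum>\<^sub>\<infinity>t. g (?h (k, t)))"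
    by (rule infsum_Sigma_banach[OF summable, symmetric])
  finally show ?thesis by simp
qed

section \<open>Products of theta functions as lattice sums\<close>

lemma theta3_minus: "theta3 (- z) \<tau> = theta3 z \<tau>"
  unfolding theta3_eq
  by (rule infsum_reindex_bij_witness[where i=uminus and j=uminus]) auto

text \<open>The expanded product of theta terms, with each argument split into a common part
  \<open>u\<close> and an individual part \<open>x j\<close>, the latter summing to zero in the
  applications.\<close>

definition lattice_term :: "nat \<Rightarrow> complex \<Rightarrow> (nat \<Rightarrow> complex) \<Rightarrow> complex \<Rightarrow> (nat \<Rightarrow> int) \<Rightarrow> complex" where
  "lattice_term n u x \<sigma> r = exp (of_real pi * \<i> * \<sigma> * (\<Sum>j=1..n. of_int (r j ^ 2))
      + 2 * \<i> * u * of_int (\<Sum>j=1..n. r j) + 2 * \<i> * (\<Sum>j=1..n. of_int (r j) * x j))"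

lemma prod_theta_term: "(\<Prod>j=1..n. theta_term (u + x j) \<sigma> (r j)) = lattice_term n u x \<sigma> r"
proof -
  have "(\<Prod>j=1..n. theta_term (u + x j) \<sigma> (r j))
    = exp (\<Sum>j=1..n. of_real pi * \<i> * \<sigma> * of_int (r j) ^ 2 + 2 * of_int (r j) * \<i> * (u + x j))"
    by (simp only: exp_sum finite_atLeastAtMost)
  also have "(\<Sum>j=1..n. of_real pi * \<i> * \<sigma> * of_int (r j) ^ 2 + 2 * of_int (r j) * \<i> * (u + x j))
    = of_real pi * \<i> * \<sigma> * (\<Sum>j=1..n. of_int (r j ^ 2))
      + 2 * \<i> * u * of_int (\<Sum>j=1..n. r j) + 2 * \<i> * (\<Sum>j=1..n. of_int (r j) * x j)"
    unfolding of_int_sum sum_distrib_left sum.distrib[symmetric]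
    by (intro sum.cong refl) (simp add: algebra_simps)
  finally show ?thesis by (simp only: lattice_term_def)
qed

lemma lattice_term_summable:
  assumes "Im \<sigma> > 0"
  shows "lattice_term n u x \<sigma> summable_on int_lattice {1..n}"
proof -
  have "(\<lambda>r. norm (\<Prod>j=1..n. theta_term (u + x j) \<sigma> (r j))) summable_on int_lattice {1..n}"
    by (intro norm_summable_on_int_lattice_prod theta_term_abs_summable assms) auto
  then show ?thesis
    unfolding prod_theta_term by (rule abs_summable_summable)
qed

lemma prod_theta3:
  assumes "Im \<sigma> > 0"
  shows "(\<Prod>j=1..n. theta3 (u + x j) \<sigma>) = infsum (lattice_term n u x \<sigma>) (int_lattice {1..n})"
proof -
  have "(\<Prod>j=1..n. theta3 (u + x j) \<sigma>) = (\<Sum>\<^sub>\<infinity>r\<in>int_lattice {1..n}. \<Prod>j=1..n. theta_term (u + x j) \<sigma> (r j))"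
    unfolding theta3_eq
    by (intro infsum_int_lattice_prod[symmetric] theta_term_abs_summable assms) auto
  then show ?thesis unfolding prod_theta_term .
qed

text \<open>Along the diagonal the linear part is unchanged because the arguments sum to zero, so a shift
  only contributes a one-dimensional theta term.\<close>

lemma lattice_term_shift_vec:
  assumes "(\<Sum>j=1..n. x j) = 0"
  shows "lattice_term n u x \<sigma> (shift_vec n c r)
    = lattice_term n u x \<sigma> r * exp (of_real pi * \<i> * \<sigma> * (2 * of_int c * of_int (\<Sum>j=1..n. r j) + of_nat n * of_int c ^ 2)
        + 2 * \<i> * u * of_nat n * of_int c)"
proof -
  have sq: "(\<Sum>j=1..n. complex_of_int (shift_vec n c r j ^ 2))
      = (\<Sum>j=1..n. of_int (r j ^ 2)) + (2 * of_int c * of_int (\<Sum>j=1..n. r j) + of_nat n * of_int c ^ 2)"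
  proof -
    have "(\<Sum>j=1..n. complex_of_int (shift_vec n c r j ^ 2))
      = (\<Sum>j=1..n. of_int (r j ^ 2) + 2 * of_int c * of_int (r j) + of_int c ^ 2)"
      by (intro sum.cong refl) (simp add: shift_vec_def power2_sum)
    also have "\<dots> = (\<Sum>j=1..n. of_int (r j ^ 2)) + (2 * of_int c * of_int (\<Sum>j=1..n. r j) + of_nat n * of_int c ^ 2)"
      by (simp add: sum.distrib sum_distrib_left)
    finally show ?thesis .
  qed
  have lin: "(\<Sum>j=1..n. of_int (shift_vec n c r j) * x j) = (\<Sum>j=1..n. of_int (r j) * x j)"
  proof -
    have "(\<Sum>j=1..n. of_int (shift_vec n c r j) * x j) = (\<Sum>j=1..n. of_int (r j) * x j + of_int c * x j)"
      by (intro sum.cong refl) (simp add: shift_vec_def algebra_simps)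
    also have "\<dots> = (\<Sum>j=1..n. of_int (r j) * x j)"
      using assms by (simp add: sum.distrib flip: sum_distrib_left)
    finally show ?thesis .
  qed
  show ?thesis
    unfolding lattice_term_def sq lin sum_shift_vec exp_add[symmetric]
    by (rule arg_cong[where f=exp]) (simp add: algebra_simps)
qed

section \<open>The two evaluations\<close>

lemma theta_product_sum_eq_lattice_sum:
  fixes \<tau> z :: complex and m n :: nat and y :: "nat \<Rightarrow> complex"
  assumes "Im \<tau> > 0" and "m > 0" and "n > 0" and y: "(\<Sum>j=1..n. y j) = 0"
  shows "(\<Sum>k<m*n. qpow \<tau> (of_nat k ^ 2 / 2) * exp (2 * of_nat k * \<i> * z)
         * (\<Prod>j=1..n. theta3 (of_nat m * z + y j + of_nat k * of_nat m * of_real pi * \<tau>)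
                              (of_nat (m^2 * n) * \<tau>)))
      = (\<Sum>k<n. qpow \<tau> (- (of_nat (m^2) * of_nat k ^ 2) / 2)
         * (\<Sum>\<^sub>\<infinity>r\<in>int_vecs n (int k).
              qpow \<tau> (of_nat (m^2 * n) * (\<Sum>j=1..n. of_int (r j ^ 2)) / 2)
              * exp (- 2 * \<i> * (\<Sum>j=1..n. of_int (r j) * y j)))) * theta3 z \<tau>"
proof -
  define \<sigma> where "\<sigma> = of_nat (m^2 * n) * \<tau>"
  define a where "a k = qpow \<tau> (of_nat k ^ 2 / 2) * exp (2 * of_nat k * \<i> * z)" for k :: nat
  \<comment> \<open>All arguments are negated, which evenness permits, so that the expansion carries
    the sign of the second form of \<open>F\<close>.\<close>
  define u where "u k = - (of_nat m * z + of_nat k * of_nat m * of_real pi * \<tau>)" for k :: nat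
  define x where "x j = - y j" for j
  define b where "b k = qpow \<tau> (- (of_nat (m^2) * of_nat k ^ 2) / 2)" for k :: nat
  define c where "c r = qpow \<tau> (of_nat (m^2 * n) * (\<Sum>j=1..n. of_int (r j ^ 2)) / 2)
              * exp (- 2 * \<i> * (\<Sum>j=1..n. of_int (r j) * y j))" for r :: "nat \<Rightarrow> int"
  have \<sigma>: "Im \<sigma> > 0" using assms by (simp add: \<sigma>_def flip: of_nat_mult of_nat_power)
  have x: "(\<Sum>j=1..n. x j) = 0" using y by (simp add: x_def sum_negf)
  have prod: "(\<Prod>j=1..n. theta3 (of_nat m * z + y j + of_nat k * of_nat m * of_real pi * \<tau>) \<sigma>)
      = (\<Sum>\<kappa><n. \<Sum>\<^sub>\<infinity>r\<in>int_vecs n (int \<kappa>). \<Sum>\<^sub>\<infinity>t::int. lattice_term n (u k) x \<sigma> (shift_vec n t r))" for k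
  proof -
    have "theta3 (of_nat m * z + y j + of_nat k * of_nat m * of_real pi * \<tau>) \<sigma> = theta3 (u k + x j) \<sigma>" for j
      by (subst theta3_minus[symmetric]) (simp add: u_def x_def algebra_simps)
    then show ?thesis
      using infsum_int_lattice_decompose[OF \<open>n > 0\<close> zero_less_one lattice_term_summable[OF \<sigma>]]
      by (simp add: prod_theta3[OF \<sigma>] del: One_nat_def)
  qed
  \<comment> \<open>Completing the square: the powers of q combine to (k - m (\<kappa> + n t))^2 / 2
    - m^2 \<kappa>^2 / 2 plus the quadratic form of r. The middle term is \<open>b \<kappa>\<close>,
    and k and t survive only in the theta index.\<close>
  have key: "a k * lattice_term n (u k) x \<sigma> (shift_vec n t r)
      = (b \<kappa> * c r) * theta_term z \<tau> (int k - int m * int \<kappa> - int (m * n) * t)"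
    if r: "r \<in> int_vecs n (int \<kappa>)" for k \<kappa> r t
  proof -
    define R Y where "R = (\<Sum>j=1..n. complex_of_int (r j ^ 2))" and "Y = (\<Sum>j=1..n. of_int (r j) * y j)"
    have s: "(\<Sum>j=1..n. r j) = int \<kappa>" using r by (simp add: int_vecs_def)
    have Yx: "(\<Sum>j=1..n. of_int (r j) * x j) = - Y" by (simp add: x_def Y_def sum_negf)
    show ?thesis
      unfolding lattice_term_shift_vec[OF x]
      unfolding lattice_term_def a_def b_def c_def qpow_def s Yx
        R_def[symmetric] Y_def[symmetric] exp_add[symmetric]
      by (rule arg_cong[where f=exp]) (simp add: u_def \<sigma>_def field_simps power2_eq_square)
  qed
  have "(\<Sum>k<m*n. a k * (\<Prod>j=1..n. theta3 (of_nat m * z + y j + of_nat k * of_nat m * of_real pi * \<tau>) \<sigma>))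
      = (\<Sum>k<m*n. \<Sum>\<kappa><n. \<Sum>\<^sub>\<infinity>r\<in>int_vecs n (int \<kappa>). \<Sum>\<^sub>\<infinity>t. a k * lattice_term n (u k) x \<sigma> (shift_vec n t r))"
    unfolding prod by (simp only: sum_distrib_left infsum_cmult_right')
  also have "\<dots> = (\<Sum>k<m*n. \<Sum>\<kappa><n. \<Sum>\<^sub>\<infinity>r\<in>int_vecs n (int \<kappa>). \<Sum>\<^sub>\<infinity>t.
      (b \<kappa> * c r) * theta_term z \<tau> (int k - int m * int \<kappa> - int (m * n) * t))"
    by (intro sum.cong refl infsum_cong key)
  also have "\<dots> = (\<Sum>k<m*n. \<Sum>\<kappa><n. (b \<kappa> * infsum c (int_vecs n (int \<kappa>)))
      * (\<Sum>\<^sub>\<infinity>t. theta_term z \<tau> (int k - int m * int \<kappa> - int (m * n) * t)))"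
    by (simp only: infsum_cmult_right' infsum_cmult_left')
  \<comment> \<open>With \<kappa> fixed, k and t together run through every integer once as theta
    index.\<close>
  also have "\<dots> = (\<Sum>\<kappa><n. (b \<kappa> * infsum c (int_vecs n (int \<kappa>)))
      * (\<Sum>k<m*n. \<Sum>\<^sub>\<infinity>t. theta_term z \<tau> (int k - int m * int \<kappa> - int (m * n) * t)))"
    unfolding sum_distrib_left by (rule sum.swap)
  also have "\<dots> = (\<Sum>\<kappa><n. (b \<kappa> * infsum c (int_vecs n (int \<kappa>))) * theta3 z \<tau>)"
    using assms
    by (simp only: infsum_int_residue_classes[OF _ theta_term_summable] theta3_eq mult_pos_pos)
  also have "\<dots> = (\<Sum>\<kappa><n. b \<kappa> * infsum c (int_vecs n (int \<kappa>))) * theta3 z \<tau>"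
    by (rule sum_distrib_right[symmetric])
  finally show ?thesis
    unfolding a_def b_def c_def \<sigma>_def .
qed

lemma sum_powers_root_of_unity:
  assumes "\<kappa> < M"
  shows "(\<Sum>k<M. exp (2 * of_real pi * \<i> * of_nat \<kappa> / of_nat M) ^ k) = (if \<kappa> = 0 then of_nat M else 0)"
proof (cases "\<kappa> = 0")
  case False
  let ?\<zeta> = "exp (2 * of_real pi * \<i> * of_nat \<kappa> / of_nat M)"
  have "\<not> M dvd \<kappa>" using False assms by (auto dest: dvd_imp_le)
  then have "?\<zeta> \<noteq> 1" using complex_root_unity_eq_1[of M \<kappa>] assms by simp
  moreover have "?\<zeta> ^ M = 1" using complex_root_unity[of M \<kappa>] assms by simp
  ultimately show ?thesis using False by (simp add: geometric_sum)
qed simp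

lemma theta_product_sum_eq_F:
  fixes \<tau> z :: complex and m n :: nat and y :: "nat \<Rightarrow> complex"
  assumes \<tau>: "Im \<tau> > 0" and mn: "m > 0" "n > 0" and y: "(\<Sum>j=1..n. y j) = 0"
  shows "(\<Sum>k<m*n. qpow \<tau> (of_nat k ^ 2 / 2) * exp (2 * of_nat k * \<i> * z)
         * (\<Prod>j=1..n. theta3 (of_nat m * z + y j + of_nat k * of_nat m * of_real pi * \<tau>)
                              (of_nat (m^2 * n) * \<tau>)))
      = F m n y \<tau> * theta3 z \<tau>"
proof -
  define \<sigma> where "\<sigma> = of_nat (m^2 * n) * \<tau>"
  define \<sigma>' where "\<sigma>' = - 1 / \<sigma>"
  define a where "a k = qpow \<tau> (of_nat k ^ 2 / 2) * exp (2 * of_nat k * \<i> * z)" for k :: nat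
  define w where "w k j = of_nat m * z + y j + of_nat k * of_nat m * of_real pi * \<tau>" for k :: nat and j :: nat
  \<comment> \<open>The common part of \<open>w k j / \<sigma>\<close>; its summand k pi / (m n) is
    the source of the roots of unity.\<close>
  define u where "u k = (z / \<tau> + of_nat k * of_real pi) / (of_nat m * of_nat n)" for k :: nat
  define x where "x j = y j / \<sigma>" for j
  define D where "D = (- \<i> * \<sigma>) powr (1/2)"
  define S where "S = (\<Sum>j=1..n. y j ^ 2)"
  define E where "E = exp (- \<i> * z\<^sup>2 / (of_real pi * \<tau>) - \<i> * S / (of_real pi * \<sigma>))"
  have \<sigma>: "Im \<sigma> > 0" using assms by (simp add: \<sigma>_def flip: of_nat_mult of_nat_power)
  have \<sigma>': "Im \<sigma>' > 0" using Im_uminus_inverse_pos[OF \<sigma>] by (simp add: \<sigma>'_def)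
  have nz: "\<tau> \<noteq> 0" "\<sigma> \<noteq> 0" using \<tau> \<sigma> by auto
  have D: "D \<noteq> 0" using nz by (simp add: D_def)
  have x: "(\<Sum>j=1..n. x j) = 0" using y by (simp add: x_def flip: sum_divide_distrib)
  have w_div: "w k j / \<sigma> = u k + x j" for k j
    using nz mn by (simp add: w_def u_def x_def \<sigma>_def field_simps power2_eq_square)
  have inv: "theta3 (w k j) \<sigma> = exp (- \<i> * w k j ^ 2 / (of_real pi * \<sigma>)) / D * theta3 (u k + x j) \<sigma>'" for k j
    using theta3_inversion[OF \<sigma>, of "w k j", folded \<sigma>'_def D_def, unfolded w_div] D
    by (simp add: exp_minus field_simps)
  have w_sq: "(\<Sum>j=1..n. w k j ^ 2) = of_nat n * of_nat m ^ 2 * (z + of_nat k * of_real pi * \<tau>)\<^sup>2 + S" for k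
  proof -
    let ?v = "of_nat m * (z + of_nat k * of_real pi * \<tau>)"
    have "(\<Sum>j=1..n. w k j ^ 2) = (\<Sum>j=1..n. ?v\<^sup>2 + 2 * ?v * y j + y j ^ 2)"
      by (intro sum.cong refl) (simp add: w_def power2_eq_square algebra_simps)
    also have "\<dots> = of_nat n * ?v\<^sup>2 + 2 * ?v * (\<Sum>j=1..n. y j) + S"
      by (simp add: sum.distrib S_def sum_distrib_left)
    finally show ?thesis using y by (simp add: power_mult_distrib)
  qed
  \<comment> \<open>The exponent contains - i (z + k pi \<tau>)^2 / (pi \<tau>), whose terms in k
    are cancelled exactly by \<open>a k\<close>.\<close>
  have a_E: "a k * exp (- \<i> * (\<Sum>j=1..n. w k j ^ 2) / (of_real pi * \<sigma>)) = E" for k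
    unfolding a_def E_def qpow_def w_sq exp_add[symmetric]
    by (rule arg_cong[where f=exp]) (use nz mn in \<open>simp add: \<sigma>_def field_simps power2_eq_square\<close>)
  have prod: "a k * (\<Prod>j=1..n. theta3 (w k j) \<sigma>) = E / D ^ n * (\<Prod>j=1..n. theta3 (u k + x j) \<sigma>')" for k
  proof -
    have "(\<Prod>j=1..n. theta3 (w k j) \<sigma>)
        = (\<Prod>j=1..n. exp (- \<i> * w k j ^ 2 / (of_real pi * \<sigma>))) / D ^ n * (\<Prod>j=1..n. theta3 (u k + x j) \<sigma>')"
      unfolding inv by (simp add: prod.distrib prod_dividef)
    also have "(\<Prod>j=1..n. exp (- \<i> * w k j ^ 2 / (of_real pi * \<sigma>)))
        = exp (- \<i> * (\<Sum>j=1..n. w k j ^ 2) / (of_real pi * \<sigma>))"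
      by (simp only: exp_sum[symmetric] finite_atLeastAtMost sum_distrib_left sum_divide_distrib)
    finally show ?thesis using a_E[of k] by (simp add: field_simps)
  qed
  \<comment> \<open>The step m fits the roots of unity: a diagonal shift by m changes the coordinate
    sum by m n.\<close>
  define L where "L k r t = lattice_term n (u k) x \<sigma>' (shift_vec n (int m * t) r)" for k r t
  define K where "K \<kappa> = (\<Sum>\<^sub>\<infinity>r\<in>int_vecs n (int \<kappa>). \<Sum>\<^sub>\<infinity>t. L 0 r t)" for \<kappa> :: nat
  define \<zeta> where "\<zeta> \<kappa> = exp (2 * of_real pi * \<i> * of_nat \<kappa> / of_nat (m * n))" for \<kappa> :: nat
  \<comment> \<open>Replacing index 0 by k adds 2 pi i k (\<kappa> + m n t) / (m n) to the exponent;
    the part with t is a multiple of 2 pi i.\<close>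
  have L_rot: "L k r t = \<zeta> \<kappa> ^ k * L 0 r t" if r: "r \<in> int_vecs n (int \<kappa>)" for k \<kappa> r t
  proof -
    define R X where "R = (\<Sum>j=1..n. complex_of_int (r j ^ 2))" and "X = (\<Sum>j=1..n. of_int (r j) * x j)"
    have s: "(\<Sum>j=1..n. r j) = int \<kappa>" using r by (simp add: int_vecs_def)
    have "L k r t = exp (of_nat k * (2 * of_real pi * \<i> * of_nat \<kappa> / of_nat (m * n))) * L 0 r t
        * exp (2 * of_real pi * \<i> * of_int (int k * t))"
      unfolding L_def lattice_term_shift_vec[OF x]
      unfolding lattice_term_def s
        R_def[symmetric] X_def[symmetric] exp_add[symmetric]
      by (rule arg_cong[where f=exp]) (use mn in \<open>simp add: u_def field_simps\<close>)
    also have "exp (2 * of_real pi * \<i> * of_int (int k * t)) = 1"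
      using exp_integer_2pi[of "of_int (int k * t)"] by (simp add: mult_ac)
    finally show ?thesis by (simp only: \<zeta>_def exp_of_nat_mult mult_1_right)
  qed
  \<comment> \<open>For coordinate sum 0 the cross term vanishes and n (m t)^2 \<sigma>' = - t^2 /
    \<tau>, so the sum over t is a theta series of modulus - 1 / \<tau>.\<close>
  have L_0: "L 0 r t = (qpow \<sigma>' ((\<Sum>j=1..n. of_int (r j ^ 2)) / 2) * exp (2 * \<i> * (\<Sum>j=1..n. of_int (r j) * x j)))
      * theta_term (z / \<tau>) (- 1 / \<tau>) t" if r: "r \<in> int_vecs n 0" for r t
  proof -
    define R X where "R = (\<Sum>j=1..n. complex_of_int (r j ^ 2))" and "X = (\<Sum>j=1..n. of_int (r j) * x j)"
    have s: "(\<Sum>j=1..n. r j) = 0" using r by (simp add: int_vecs_def)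
    show ?thesis
      unfolding L_def lattice_term_shift_vec[OF x]
      unfolding lattice_term_def s qpow_def
        R_def[symmetric] X_def[symmetric] exp_add[symmetric]
      by (rule arg_cong[where f=exp])
         (use mn nz in \<open>simp add: u_def \<sigma>'_def \<sigma>_def field_simps power2_eq_square\<close>)
  qed
  have prod': "(\<Prod>j=1..n. theta3 (u k + x j) \<sigma>') = (\<Sum>\<kappa><m * n. \<zeta> \<kappa> ^ k * K \<kappa>)" for k
  proof -
    have "(\<Prod>j=1..n. theta3 (u k + x j) \<sigma>') = (\<Sum>\<kappa><m * n. \<Sum>\<^sub>\<infinity>r\<in>int_vecs n (int \<kappa>). \<Sum>\<^sub>\<infinity>t. L k r t)"
      unfolding prod_theta3[OF \<sigma>'] L_def
      by (rule infsum_int_lattice_decompose[OF mn(2,1) lattice_term_summable[OF \<sigma>']])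
    also have "\<dots> = (\<Sum>\<kappa><m * n. \<Sum>\<^sub>\<infinity>r\<in>int_vecs n (int \<kappa>). \<Sum>\<^sub>\<infinity>t. \<zeta> \<kappa> ^ k * L 0 r t)"
      by (intro sum.cong refl infsum_cong L_rot)
    finally show ?thesis unfolding K_def by (simp only: infsum_cmult_right')
  qed
  have "(\<Sum>k<m*n. a k * (\<Prod>j=1..n. theta3 (w k j) \<sigma>)) = E / D ^ n * (\<Sum>k<m*n. \<Sum>\<kappa><m*n. \<zeta> \<kappa> ^ k * K \<kappa>)"
    unfolding prod prod' by (rule sum_distrib_left[symmetric])
  also have "(\<Sum>k<m*n. \<Sum>\<kappa><m*n. \<zeta> \<kappa> ^ k * K \<kappa>) = (\<Sum>\<kappa><m*n. (\<Sum>k<m*n. \<zeta> \<kappa> ^ k) * K \<kappa>)"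
    unfolding sum_distrib_right by (rule sum.swap)
  also have "\<dots> = (\<Sum>\<kappa><m*n. if \<kappa> = 0 then of_nat (m * n) * K 0 else 0)"
    unfolding \<zeta>_def by (intro sum.cong refl) (subst sum_powers_root_of_unity, auto)
  \<comment> \<open>The factor m n, the number of values of k, is the one built into
    \<open>G\<close>.\<close>
  also have "\<dots> = of_nat (m * n) * K 0"
    using mn by simp
  also have "K 0 = (\<Sum>\<^sub>\<infinity>r\<in>int_vecs n 0. qpow \<sigma>' ((\<Sum>j=1..n. of_int (r j ^ 2)) / 2) * exp (2 * \<i> * (\<Sum>j=1..n. of_int (r j) * x j)))
      * theta3 (z / \<tau>) (- 1 / \<tau>)"
  proof -
    have "K 0 = (\<Sum>\<^sub>\<infinity>r\<in>int_vecs n 0. \<Sum>\<^sub>\<infinity>t. (qpow \<sigma>' ((\<Sum>j=1..n. of_int (r j ^ 2)) / 2)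
        * exp (2 * \<i> * (\<Sum>j=1..n. of_int (r j) * x j))) * theta_term (z / \<tau>) (- 1 / \<tau>) t)"
      unfolding K_def of_nat_0 by (intro infsum_cong L_0)
    then show ?thesis by (simp only: infsum_cmult_right' infsum_cmult_left' theta3_eq)
  qed
  also have "of_nat (m * n) * (\<dots>) = G m n x \<sigma>' * theta3 (z / \<tau>) (- 1 / \<tau>)"
    by (simp only: G_def mult.assoc)
  also have "theta3 (z / \<tau>) (- 1 / \<tau>) = (- \<i> * \<tau>) powr (1/2) * exp (\<i> * z\<^sup>2 / (of_real pi * \<tau>)) * theta3 z \<tau>"
    by (rule theta3_inversion[OF \<tau>])
  also have "E / D ^ n * (G m n x \<sigma>' * \<dots>)
      = ((- \<i> * \<tau>) powr (1/2) / D ^ n) * (E * exp (\<i> * z\<^sup>2 / (of_real pi * \<tau>))) * G m n x \<sigma>' * theta3 z \<tau>"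
    by simp
  also have "E * exp (\<i> * z\<^sup>2 / (of_real pi * \<tau>)) = exp (S / (of_nat (m^2 * n) * of_real pi * \<tau> * \<i>))"
    unfolding E_def exp_add[symmetric]
    by (rule arg_cong[where f=exp]) (use mn nz in \<open>simp add: \<sigma>_def field_simps\<close>)
  also have "(- \<i> * \<tau>) powr (1/2) / D ^ n
      = (- \<i> * \<tau>) powr ((1 - of_nat n) / 2) / (of_nat (m^2 * n)) powr (of_nat n / 2)"
  proof -
    have pow: "(v powr (1/2)) ^ n = v powr (of_nat n / 2)" if "v \<noteq> 0" for v :: complex
      using that by (simp add: powr_def exp_of_nat_mult[symmetric])
    have "D = (of_nat (m^2 * n) * (- \<i> * \<tau>)) powr (1/2)"
      by (simp add: D_def \<sigma>_def mult_ac)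
    \<comment> \<open>Principal powers are not multiplicative in general; here one factor is a
      nonnegative real.\<close>
    also have "\<dots> = of_nat (m^2 * n) powr (1/2) * (- \<i> * \<tau>) powr (1/2)"
      by (rule powr_times_real_left) (auto simp flip: of_nat_mult of_nat_power)
    finally have "D ^ n = of_nat (m^2 * n) powr (of_nat n / 2) * (- \<i> * \<tau>) powr (of_nat n / 2)"
      using nz mn by (simp add: power_mult_distrib pow)
    moreover have "(- \<i> * \<tau>) powr ((1 - of_nat n) / 2) = (- \<i> * \<tau>) powr (1/2) / (- \<i> * \<tau>) powr (of_nat n / 2)"
      by (simp only: diff_divide_distrib powr_diff)
    ultimately show ?thesis by (simp add: mult_ac)
  qed
  finally show ?thesis
    unfolding F_def a_def w_def S_def x_def \<sigma>'_def \<sigma>_def by simp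
qed

theorem theorem2p1:
  fixes \<tau> :: complex and m n :: nat and y :: "nat \<Rightarrow> complex"
  assumes "Im \<tau> > 0" and "m > 0" and "n > 0"
    and "(\<Sum>j=1..n. y j) = 0"
  shows "(\<forall>z::complex.
      (\<Sum>k<m*n. qpow \<tau> (of_nat k ^ 2 / 2) * exp (2 * of_nat k * \<i> * z)
         * (\<Prod>j=1..n. theta3 (of_nat m * z + y j + of_nat k * of_nat m * of_real pi * \<tau>)
                              (of_nat (m^2 * n) * \<tau>)))
      = F m n y \<tau> * theta3 z \<tau>)
    \<and> F m n y \<tau> =
      (\<Sum>k<n. qpow \<tau> (- (of_nat (m^2) * of_nat k ^ 2) / 2)
         * (\<Sum>\<^sub>\<infinity>r\<in>int_vecs n (int k).
              qpow \<tau> (of_nat (m^2 * n) * (\<Sum>j=1..n. of_int (r j ^ 2)) / 2)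
              * exp (- 2 * \<i> * (\<Sum>j=1..n. of_int (r j) * y j))))"
proof -
  obtain z where z: "theta3 z \<tau> \<noteq> 0"
  proof (rule ccontr)
    assume "\<not> thesis"
    then have "theta3 z \<tau> = 0" for z using that by blast
    then show False using theta3_fourier_coefficient[OF assms(1), of 0] by simp
  qed
  have "F m n y \<tau> * theta3 z \<tau> = (\<Sum>k<n. qpow \<tau> (- (of_nat (m^2) * of_nat k ^ 2) / 2)
         * (\<Sum>\<^sub>\<infinity>r\<in>int_vecs n (int k).
              qpow \<tau> (of_nat (m^2 * n) * (\<Sum>j=1..n. of_int (r j ^ 2)) / 2)
              * exp (- 2 * \<i> * (\<Sum>j=1..n. of_int (r j) * y j)))) * theta3 z \<tau>"
    by (rule trans[OF theta_product_sum_eq_F[OF assms, symmetric] theta_product_sum_eq_lattice_sum[OF assms]])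
  \<comment> \<open>Neither form of \<open>F\<close> involves z, so cancelling at one point where
    theta is nonzero suffices.\<close>
  with z theta_product_sum_eq_F[OF assms] show ?thesis
    unfolding mult_cancel_right by blast
qed

end
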